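(* Let $X$ be a Banach space and let $\rho\colon[0,\infty)\to[0,\infty)$ be a strictly increasing $C^1$ function with $\rho(0)=0$ and $\lim_{t\to\infty}\rho(t)=\infty$. Assume that the evolution family $\mathcal{T}=\{T(t,s)\}_{t\ge s\ge 0}$ on $X$ admits a $\rho$-nonuniform exponential dichotomy, with constants $\lambda,D>0$ and $\varepsilon\ge 0$. Then for every $a>0$ there exists $\delta_0>0$ such that for every $\delta\in(0,\delta_0)$ the following holds: if $B\colon[0,\infty)\to\mathcal{B}(X)$ is a strongly continuous operator-valued function with $$\|B(t)\|\le\delta e^{-(\varepsilon+a)\rho(t)}\rho'(t),\quad t\ge 0,$$ then the perturbed evolution family $\{U(t,s)\}_{t\ge s\ge 0}$ satisfying $$U(t,s)=T(t,s)+\int_s^t T(t,\tau)B(\tau)U(\tau,s)\,d\tau,\quad t\ge s\ge 0,$$ also admits a $\rho$-nonuniform exponential dichotomy.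
   Context: $\mathcal{B}(X)$ is the algebra of bounded linear operators on the Banach space $(X,\|\cdot\|)$. Operator-valued integrals are understood pointwise (strongly). A family $\{T(t,s)\}_{t\ge s\ge 0}\subset\mathcal{B}(X)$ is an evolution family if $T(t,t)=\mathrm{Id}$ for $t\ge 0$; $T(t,s)T(s,\tau)=T(t,\tau)$ for $t\ge s\ge\tau\ge 0$; and for all $s\ge 0$, $x\in X$ the map $t\mapsto T(t,s)x$ is continuous on $[s,\infty)$ and the map $t\mapsto T(s,t)x$ is continuous on $[0,s]$. $\rho$-nonuniform exponential dichotomy: an evolution family $\{T(t,s)\}_{t\ge s\ge 0}$ admits a $\rho$-nonuniform exponential dichotomy if there is a family $\{P(t)\}_{t\ge 0}$ of projections on $X$ with $T(t,s)P(s)=P(t)T(t,s)$ for $t\ge s\ge 0$, such that $T(t,s)|_{\operatorname{Ker}P(s)}\colon\operatorname{Ker}P(s)\to\operatorname{Ker}P(t)$ is invertible for all $t\ge s\ge 0$, and there are constants $\lambda,D>0$ and $\varepsilon\ge 0$ such that $\|T(t,s)P(s)\|\le De^{-\lambda(\rho(t)-\rho(s))+\varepsilon\rho(s)}$ for $t\ge s\ge 0$, and $\|T(t,s)(\mathrm{Id}-P(s))\|\le De^{-\lambda(\rho(s)-\rho(t))+\varepsilon\rho(s)}$ for $0\le t\le s$, where for $0\le t\le s$ one sets $T(t,s):=(T(s,t)|_{\operatorname{Ker}P(t)})^{-1}\colon\operatorname{Ker}P(s)\to\operatorname{Ker}P(t)$. The constants in the dichotomy of $U$ may differ from those of $T$.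 *)

theory Defs
  imports "HOL-Analysis.Analysis"
begin

text \<open>
  Evolution families are total in both parameters, but only the values \<open>T t s\<close> with
  \<open>t \<ge> s \<ge> 0\<close> are ever constrained or used.
\<close>

definition evolution_family :: "(real \<Rightarrow> real \<Rightarrow> ('a::banach \<Rightarrow>\<^sub>L 'a)) \<Rightarrow> bool" where
  "evolution_family T \<longleftrightarrow>
     (\<forall>t\<ge>0. T t t = id_blinfun) \<and>
     (\<forall>t s \<tau>. t \<ge> s \<and> s \<ge> \<tau> \<and> \<tau> \<ge> 0 \<longrightarrow> T t s o\<^sub>L T s \<tau> = T t \<tau>) \<and>
     (\<forall>s\<ge>0. \<forall>x. continuous_on {s..} (\<lambda>t. T t s x)) \<and>
     (\<forall>s\<ge>0. \<forall>x. continuous_on {0..s} (\<lambda>t. T s t x))"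

definition strongly_continuous_on :: "real set \<Rightarrow> (real \<Rightarrow> ('a::banach \<Rightarrow>\<^sub>L 'a)) \<Rightarrow> bool" where
  "strongly_continuous_on S B \<longleftrightarrow> (\<forall>x. continuous_on S (\<lambda>t. B t x))"

definition ker :: "('a::real_normed_vector \<Rightarrow>\<^sub>L 'b::real_normed_vector) \<Rightarrow> 'a set" where
  "ker A = {x. A x = 0}"

text \<open>The operator \<open>T(t, s) : Ker P(s) \<rightarrow> Ker P(t)\<close> for \<open>0 \<le> t \<le> s\<close>; its values
  outside \<open>Ker P(s)\<close> are irrelevant.\<close>

definition backward ::
  "(real \<Rightarrow> real \<Rightarrow> ('a::banach \<Rightarrow>\<^sub>L 'a)) \<Rightarrow> (real \<Rightarrow> ('a \<Rightarrow>\<^sub>L 'a)) \<Rightarrow> real \<Rightarrow> real \<Rightarrow> 'a \<Rightarrow> 'a" where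
  "backward T P t s = inv_into (ker (P t)) (blinfun_apply (T s t))"

text \<open>
  The backward operators are not bundled as bounded operators, so the last estimate uses
  \<^const>\<open>onorm\<close>, which is a meaningful operator norm only for bounded linear maps.
  Boundedness itself is automatic, by the bounded inverse theorem.
\<close>

definition nonuniform_exp_dichotomy_with ::
  "(real \<Rightarrow> real) \<Rightarrow> (real \<Rightarrow> real \<Rightarrow> ('a::banach \<Rightarrow>\<^sub>L 'a)) \<Rightarrow> real \<Rightarrow> real \<Rightarrow> real \<Rightarrow> bool" where
  "nonuniform_exp_dichotomy_with \<rho> T lam D \<epsilon> \<longleftrightarrow>
     lam > 0 \<and> D > 0 \<and> \<epsilon> \<ge> 0 \<and>
     (\<exists>P :: real \<Rightarrow> ('a \<Rightarrow>\<^sub>L 'a).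
        (\<forall>t\<ge>0. P t o\<^sub>L P t = P t) \<and>
        (\<forall>t s. t \<ge> s \<and> s \<ge> 0 \<longrightarrow> T t s o\<^sub>L P s = P t o\<^sub>L T t s) \<and>
        (\<forall>t s. t \<ge> s \<and> s \<ge> 0 \<longrightarrow> bij_betw (T t s) (ker (P s)) (ker (P t))) \<and>
        (\<forall>t s. t \<ge> s \<and> s \<ge> 0 \<longrightarrow>
           norm (T t s o\<^sub>L P s) \<le> D * exp (- lam * (\<rho> t - \<rho> s) + \<epsilon> * \<rho> s)) \<and>
        (\<forall>t s. 0 \<le> t \<and> t \<le> s \<longrightarrow>
           bounded_linear (\<lambda>x. backward T P t s ((id_blinfun - P s) x)) \<and>
           onorm (\<lambda>x. backward T P t s ((id_blinfun - P s) x))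
             \<le> D * exp (- lam * (\<rho> s - \<rho> t) + \<epsilon> * \<rho> s)))"

definition nonuniform_exp_dichotomy ::
  "(real \<Rightarrow> real) \<Rightarrow> (real \<Rightarrow> real \<Rightarrow> ('a::banach \<Rightarrow>\<^sub>L 'a)) \<Rightarrow> bool" where
  "nonuniform_exp_dichotomy \<rho> T \<longleftrightarrow> (\<exists>lam D \<epsilon>. nonuniform_exp_dichotomy_with \<rho> T lam D \<epsilon>)"

text \<open>Existence of the integral is stated explicitly because \<^const>\<open>integral\<close> is total.\<close>

definition perturbed_by ::
  "(real \<Rightarrow> real \<Rightarrow> ('a::banach \<Rightarrow>\<^sub>L 'a)) \<Rightarrow> (real \<Rightarrow> ('a \<Rightarrow>\<^sub>L 'a)) \<Rightarrow>
   (real \<Rightarrow> real \<Rightarrow> ('a \<Rightarrow>\<^sub>L 'a)) \<Rightarrow> bool" where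
  "perturbed_by T B U \<longleftrightarrow>
     (\<forall>t s x. t \<ge> s \<and> s \<ge> 0 \<longrightarrow>
        (\<lambda>\<tau>. T t \<tau> (B \<tau> (U \<tau> s x))) integrable_on {s..t} \<and>
        U t s x = T t s x + integral {s..t} (\<lambda>\<tau>. T t \<tau> (B \<tau> (U \<tau> s x))))"

end

theory Submission
  imports Defs
begin

text \<open>
  Let \<open>G(t, \<tau>)\<close> be the Green kernel of \<open>T\<close>: \<open>T(t, \<tau>)P(\<tau>)\<close> for \<open>\<tau> \<le> t\<close> and
  \<open>- T(t, \<tau>)(Id - P(\<tau>))\<close> for \<open>\<tau> > t\<close>. The nonuniform factor \<open>exp (\<epsilon> \<rho>(\<tau>))\<close> of \<open>G(t, \<tau>)\<close> is absorbed
  by \<open>B(\<tau>)\<close>, and what remains, \<open>exp (- a \<rho>(\<tau>)) \<rho>'(\<tau>)\<close>, has integral \<open>1/a\<close>. Hence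
  \<open>(K \<phi>)(t) = \<integral> G(t, \<tau>) B(\<tau>) \<phi>(\<tau>) d\<tau>\<close> is a contraction with constant \<open>q = D \<delta> / a\<close>, both in the sup norm and
  in the norms with weight \<open>exp (- lam \<bar>\<rho>(t) - \<rho>(s)\<bar>)\<close>. The solution of \<open>\<phi> = G(\<cdot>, s)x + K \<phi>\<close>
  jumps by \<open>x\<close> at time \<open>s\<close>; on either side of \<open>s\<close> it is an orbit of \<open>U\<close>. The jump thus splits \<open>x\<close> into
  the initial value of a decaying forward orbit and the end point of an orbit issuing from the kernel of
  \<open>P(0)\<close>, and the splitting is unique. This gives the dichotomy of \<open>U\<close> with the same exponents
  and the constant \<open>D / (1 - q)\<close>.
\<close>

section \<open>Piecewise continuous functions and operator kernels\<close>

text \<open>Functions with at most one jump, at time \<open>s\<close>, such as the solutions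
  \<open>\<phi>\<close> used later. Both branches are continuous on the whole half-line, so local
  bounds come from compactness. At \<open>s\<close> itself the right branch counts.\<close>

definition cont_except :: "real \<Rightarrow> (real \<Rightarrow> 'a::real_normed_vector) \<Rightarrow> bool" where
  "cont_except s f \<longleftrightarrow> (\<exists>f1 f2. continuous_on {0..} f1 \<and> continuous_on {0..} f2 \<and>
     (\<forall>t\<ge>0. f t = (if t < s then f1 t else f2 t)))"

definition operator_kernel :: "(real \<Rightarrow> ('a::banach \<Rightarrow>\<^sub>L 'a)) \<Rightarrow> bool" where
  "operator_kernel H \<longleftrightarrow> strongly_continuous_on {0..} H \<and> (\<forall>N. \<exists>M. \<forall>t\<in>{0..N}. norm (H t) \<le> M)"

lemma continuous_imp_cont_except: "continuous_on {0..} f \<Longrightarrow> cont_except s f"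
  unfolding cont_except_def by (intro exI[of _ f]) auto

lemma cont_except_add:
  assumes "cont_except s f" "cont_except s g"
  shows "cont_except s (\<lambda>t. f t + g t)"
proof -
  obtain f1 f2 where f: "continuous_on {0..} f1" "continuous_on {0..} f2"
    "\<And>t. t\<ge>0 \<Longrightarrow> f t = (if t < s then f1 t else f2 t)"
    using assms(1) unfolding cont_except_def by blast
  obtain g1 g2 where g: "continuous_on {0..} g1" "continuous_on {0..} g2"
    "\<And>t. t\<ge>0 \<Longrightarrow> g t = (if t < s then g1 t else g2 t)"
    using assms(2) unfolding cont_except_def by blast
  have "continuous_on {0..} (\<lambda>t. f1 t + g1 t)" "continuous_on {0..} (\<lambda>t. f2 t + g2 t)"
    using f g by (auto intro: continuous_on_add)
  then show ?thesis unfolding cont_except_def using f(3) g(3)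
    by (intro exI[of _ "\<lambda>t. f1 t + g1 t"] exI[of _ "\<lambda>t. f2 t + g2 t"]) auto
qed

text \<open>Compare through \<open>H t (f t0)\<close>: the local norm bound controls the change of
  \<open>f\<close>, strong continuity the change of \<open>H\<close>.\<close>

lemma continuous_on_kernel_apply:
  assumes H: "operator_kernel H" and f: "continuous_on {0..} f"
  shows "continuous_on {0..} (\<lambda>t. H t (f t))"
  unfolding continuous_on_iff
proof (intro ballI allI impI)
  fix t0 e :: real assume t0: "t0 \<in> {0..}" and e: "0 < e"
  obtain M where M: "\<And>t. t \<in> {0..t0+1} \<Longrightarrow> norm (H t) \<le> M"
    using H unfolding operator_kernel_def by blast
  have "norm (H t0) \<le> M" by (rule M) (use t0 in simp)
  then have M0: "0 \<le> M" using norm_ge_zero[of "H t0"] by linarith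
  have "continuous_on {0..} (\<lambda>t. H t (f t0))"
    using H unfolding operator_kernel_def strongly_continuous_on_def by blast
  then obtain d1 where d1: "d1 > 0"
    "\<And>t. t \<in> {0..} \<Longrightarrow> dist t t0 < d1 \<Longrightarrow> dist (H t (f t0)) (H t0 (f t0)) < e / 2"
    using t0 e unfolding continuous_on_iff by (meson half_gt_zero)
  have "e / (2 * (M + 1)) > 0" using e M0 by auto
  then obtain d2 where d2: "d2 > 0"
    "\<And>t. t \<in> {0..} \<Longrightarrow> dist t t0 < d2 \<Longrightarrow> dist (f t) (f t0) < e / (2 * (M + 1))"
    using f t0 unfolding continuous_on_iff by meson
  show "\<exists>d>0. \<forall>t\<in>{0..}. dist t t0 < d \<longrightarrow> dist (H t (f t)) (H t0 (f t0)) < e"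
  proof (intro exI[of _ "min 1 (min d1 d2)"] conjI ballI impI)
    fix t :: real assume t: "t \<in> {0..}" "dist t t0 < min 1 (min d1 d2)"
    then have "t \<in> {0..t0+1}" by (auto simp: dist_real_def)
    have "norm (H t (f t) - H t (f t0)) \<le> norm (H t) * norm (f t - f t0)"
      by (metis blinfun.diff_right norm_blinfun)
    also have "\<dots> \<le> (M + 1) * norm (f t - f t0)"
      using M[OF \<open>t \<in> {0..t0+1}\<close>] by (intro mult_right_mono) auto
    also have "\<dots> < (M + 1) * (e / (2 * (M + 1)))"
      using d2(2)[of t] t M0 by (intro mult_strict_left_mono) (auto simp: dist_norm)
    also have "\<dots> = e / 2" using M0 by (simp add: field_simps)
    finally have "dist (H t (f t)) (H t (f t0)) < e / 2" by (simp add: dist_norm)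
    moreover have "dist (H t (f t0)) (H t0 (f t0)) < e / 2" using d1(2)[of t] t by auto
    ultimately show "dist (H t (f t)) (H t0 (f t0)) < e"
      using dist_triangle[of "H t (f t)" "H t0 (f t0)" "H t (f t0)"] by linarith
  qed (use d1(1) d2(1) in auto)
qed

lemma cont_except_kernel_apply:
  assumes "operator_kernel H" "cont_except s f"
  shows "cont_except s (\<lambda>t. H t (f t))"
proof -
  obtain f1 f2 where
    "continuous_on {0..} f1" "continuous_on {0..} f2" "\<forall>t\<ge>0. f t = (if t < s then f1 t else f2 t)"
    using assms unfolding cont_except_def by blast
  then show ?thesis unfolding cont_except_def
    by (intro exI[of _ "\<lambda>t. H t (f1 t)"] exI[of _ "\<lambda>t. H t (f2 t)"])
       (auto intro: continuous_on_kernel_apply[OF assms(1)])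
qed

lemma cont_except_integrable:
  fixes f :: "real \<Rightarrow> 'a::banach"
  assumes "cont_except s f" "0 \<le> u"
  shows "f integrable_on {u..v}"
proof -
  obtain f1 f2 where f: "continuous_on {0..} f1" "continuous_on {0..} f2"
    "\<And>t. t\<ge>0 \<Longrightarrow> f t = (if t < s then f1 t else f2 t)"
    using assms unfolding cont_except_def by blast
  have 1: "f integrable_on {x..y}" if "0 \<le> x" "y \<le> s" for x y
  \<comment> \<open>The value at \<open>s\<close> belongs to \<open>f2\<close>, so on an interval
    ending at \<open>s\<close> the function agrees with \<open>f1\<close> only off the point
    \<open>s\<close>.\<close>
  proof (rule integrable_spike[of f1 "{x..y}" "{s}"])
    show "f1 integrable_on {x..y}"
      by (rule integrable_continuous_real, rule continuous_on_subset[OF f(1)]) (use that in auto)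
  qed (use that f(3) in auto)
  have 2: "f integrable_on {x..y}" if "0 \<le> x" "s \<le> x" for x y
  proof (rule integrable_eq[of f2])
    show "f2 integrable_on {x..y}"
      by (rule integrable_continuous_real, rule continuous_on_subset[OF f(2)]) (use that in auto)
  qed (use that f(3) in auto)
  show ?thesis
  proof (cases "u \<le> s \<and> s \<le> v")
    case True
    then show ?thesis using 1[of u s] 2[of s v] assms(2)
      by (intro Henstock_Kurzweil_Integration.integrable_combine[of u s v f]) auto
  next
    case False
    then show ?thesis using 1[of u v] 2[of u v] assms(2) by linarith
  qed
qed

lemma cont_except_bounded:
  assumes "cont_except s f"
  shows "\<exists>C\<ge>0. \<forall>t\<in>{0..N}. norm (f t) \<le> C"
proof -
  obtain f1 f2 where f: "continuous_on {0..} f1" "continuous_on {0..} f2"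
    "\<And>t. t\<ge>0 \<Longrightarrow> f t = (if t < s then f1 t else f2 t)"
    using assms unfolding cont_except_def by blast
  have "bounded (f1 ` {0..N})" "bounded (f2 ` {0..N})"
    by (intro compact_imp_bounded compact_continuous_image compact_Icc
        continuous_on_subset[OF f(1)] continuous_on_subset[OF f(2)]; auto)+
  then obtain C1 C2 where "\<forall>t\<in>{0..N}. norm (f1 t) \<le> C1" "\<forall>t\<in>{0..N}. norm (f2 t) \<le> C2"
    unfolding bounded_iff by auto
  then show ?thesis using f(3)
    by (intro exI[of _ "max 0 (max C1 C2)"]) (auto simp: le_max_iff_disj)
qed

text \<open>If \<open>f\<close> is not integrable, its \<open>integral\<close> is 0 by default, and
  the nonnegative majorant gives \<open>0 \<le> I\<close>. Hence estimates require only the integral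
  of the majorant.\<close>

lemma integral_norm_bound_integral_le:
  fixes f :: "real \<Rightarrow> 'a::banach"
  assumes g: "(g has_integral I) S" and le: "\<And>x. x \<in> S \<Longrightarrow> norm (f x) \<le> g x"
  shows "norm (integral S f) \<le> I"
proof (cases "f integrable_on S")
  case True
  then show ?thesis
    using integral_norm_bound_integral[OF True, of g] g le by (auto simp: has_integral_iff)
next
  case False
  have "0 \<le> g x" if "x \<in> S" for x using le[OF that] norm_ge_zero order_trans by blast
  then have "0 \<le> I" using has_integral_nonneg[OF g] by blast
  then show ?thesis using False by (simp add: not_integrable_integral)
qed

section \<open>Evolution families with a dichotomy\<close>

text \<open>\<open>J t\<close> is the backward operator from time \<open>t\<close> to time \<open>0\<close> after projecting to \<open>Ker P(t)\<close>; thus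
  \<open>T t 0 (J s x)\<close> plays the role of \<open>T(t, s)(Id - P(s))x\<close> for \<open>t \<le> s\<close>.\<close>
locale perturbed_dichotomy =
  fixes \<rho> \<rho>' :: "real \<Rightarrow> real"
    and T U :: "real \<Rightarrow> real \<Rightarrow> ('a::banach \<Rightarrow>\<^sub>L 'a)"
    and P J B :: "real \<Rightarrow> ('a \<Rightarrow>\<^sub>L 'a)"
    and lam D \<epsilon> a \<delta> :: real
  assumes mono: "\<And>s t. 0 \<le> s \<Longrightarrow> s \<le> t \<Longrightarrow> \<rho> s \<le> \<rho> t"
    and rho_0: "\<rho> 0 = 0"
    and rho_deriv: "\<And>t. 0 \<le> t \<Longrightarrow> (\<rho> has_real_derivative \<rho>' t) (at t within {0..})"
    and rho'_cont: "continuous_on {0..} \<rho>'"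
    and rho_lim: "filterlim \<rho> at_top at_top"
    and T_evol: "evolution_family T"
    and U_evol: "evolution_family U"
    and U_pert: "perturbed_by T B U"
    and P_idem: "\<And>t x. 0 \<le> t \<Longrightarrow> P t (P t x) = P t x"
    and T_P: "\<And>t s x. 0 \<le> s \<Longrightarrow> s \<le> t \<Longrightarrow> T t s (P s x) = P t (T t s x)"
    and P_J: "\<And>t x. 0 \<le> t \<Longrightarrow> P 0 (J t x) = 0"
    and T_J: "\<And>t x. 0 \<le> t \<Longrightarrow> T t 0 (J t x) = x - P t x"
    and J_T: "\<And>t s x. 0 \<le> s \<Longrightarrow> s \<le> t \<Longrightarrow> J t (T t s x) = J s x"
    and pos: "0 < lam" "0 < D" "0 \<le> \<epsilon>" "0 < a" "0 < \<delta>"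
    and bound_P: "\<And>t s x. 0 \<le> s \<Longrightarrow> s \<le> t \<Longrightarrow>
       norm (T t s (P s x)) \<le> D * exp (- lam * (\<rho> t - \<rho> s) + \<epsilon> * \<rho> s) * norm x"
    and bound_J: "\<And>t s x. 0 \<le> t \<Longrightarrow> t \<le> s \<Longrightarrow>
       norm (T t 0 (J s x)) \<le> D * exp (- lam * (\<rho> s - \<rho> t) + \<epsilon> * \<rho> s) * norm x"
    and B_cont: "strongly_continuous_on {0..} B"
    and B_bound: "\<And>t. 0 \<le> t \<Longrightarrow> norm (B t) \<le> \<delta> * exp (- (\<epsilon> + a) * \<rho> t) * \<rho>' t"
    and small: "D * \<delta> / a < 1"
begin

lemma T_id [simp]: "0 \<le> t \<Longrightarrow> T t t x = x"
  and T_comp: "0 \<le> r \<Longrightarrow> r \<le> s \<Longrightarrow> s \<le> t \<Longrightarrow> T t s (T s r x) = T t r x"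
  and T_cont: "0 \<le> s \<Longrightarrow> continuous_on {s..} (\<lambda>t. T t s x)"
  and T_cont2: "0 \<le> t \<Longrightarrow> continuous_on {0..t} (\<lambda>s. T t s x)"
  using T_evol unfolding evolution_family_def
  by (auto simp flip: blinfun_apply_blinfun_compose)

lemma U_id [simp]: "0 \<le> t \<Longrightarrow> U t t x = x"
  and U_comp: "0 \<le> r \<Longrightarrow> r \<le> s \<Longrightarrow> s \<le> t \<Longrightarrow> U t s (U s r x) = U t r x"
  and U_cont: "0 \<le> s \<Longrightarrow> continuous_on {s..} (\<lambda>t. U t s x)"
  using U_evol unfolding evolution_family_def
  by (auto simp flip: blinfun_apply_blinfun_compose)

lemma J_0: "J 0 x = x - P 0 x"
  using T_J[of 0 x] by simp

text \<open>By \<open>J_T\<close> from time 0, \<open>J t\<close> is a left inverse of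
  \<open>T t 0\<close> on the kernel of \<open>P 0\<close>; so \<open>T t 0\<close> is injective
  there, and it sends \<open>J t (P t x)\<close> to 0.\<close>

lemma J_P:
  assumes "0 \<le> t"
  shows "J t (P t x) = 0"
proof -
  have "T t 0 (J t (P t x)) = 0" using T_J P_idem assms by simp
  then show ?thesis using J_T[of 0 t "J t (P t x)"] J_0 P_J assms by (simp add: blinfun.zero_right)
qed

lemma rho_nonneg: "0 \<le> t \<Longrightarrow> 0 \<le> \<rho> t"
  using mono[of 0 t] rho_0 by simp

text \<open>On the unstable part, going back from \<open>s\<close> to 0 and then forward to
  \<open>t\<close> amounts to going from \<open>s\<close> to \<open>t\<close>.\<close>

lemma T_split: "0 \<le> s \<Longrightarrow> s \<le> t \<Longrightarrow> T t s x = T t s (P s x) + T t 0 (J s x)"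
  using T_J[of s x] T_comp[of 0 s t "J s x", symmetric] by (simp add: blinfun.diff_right)

lemma bound_J0:
  assumes "0 \<le> t" "t \<le> N"
  shows "norm (J t) \<le> D * exp (\<epsilon> * \<rho> N)"
proof (rule norm_blinfun_bound)
  show "0 \<le> D * exp (\<epsilon> * \<rho> N)" using pos by simp
  fix x
  have "norm (J t x) \<le> D * exp (- lam * (\<rho> t - \<rho> 0) + \<epsilon> * \<rho> t) * norm x"
    using bound_J[of 0 t x] assms by simp
  also have "- lam * (\<rho> t - \<rho> 0) + \<epsilon> * \<rho> t \<le> \<epsilon> * \<rho> N"
  proof -
    have "0 \<le> lam * \<rho> t" using pos rho_nonneg[of t] assms by simp
    moreover have "\<epsilon> * \<rho> t \<le> \<epsilon> * \<rho> N" using pos mono[of t N] assms by (simp add: mult_left_mono)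
    ultimately show ?thesis using rho_0 by simp
  qed
  then have "D * exp (- lam * (\<rho> t - \<rho> 0) + \<epsilon> * \<rho> t) * norm x \<le> D * exp (\<epsilon> * \<rho> N) * norm x"
    using pos by (intro mult_right_mono mult_left_mono) auto
  finally show "norm (J t x) \<le> D * exp (\<epsilon> * \<rho> N) * norm x" by simp
qed

text \<open>Going back from time \<open>N\<close> bounds \<open>T t 0\<close> on the unstable space for all \<open>t \<le> N\<close> at once,
  so the uniform boundedness principle is not needed.\<close>
lemma T_bound:
  "\<exists>M\<ge>0. \<forall>t s. 0 \<le> s \<and> s \<le> t \<and> t \<le> N \<longrightarrow> norm (T t s) \<le> M"
proof -
  define E where "E = D * exp (\<epsilon> * \<rho> N)"
  have E: "0 \<le> E" using pos by (simp add: E_def)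
  have eE: "D * exp (- lam * (\<rho> v - \<rho> u) + \<epsilon> * \<rho> w) \<le> E"
    if "0 \<le> u" "u \<le> v" "0 \<le> w" "w \<le> N" for u v w
  proof -
    have "0 \<le> lam * (\<rho> v - \<rho> u)" using pos mono[of u v] that by simp
    moreover have "\<epsilon> * \<rho> w \<le> \<epsilon> * \<rho> N" using pos mono[of w N] that by (simp add: mult_left_mono)
    ultimately show ?thesis unfolding E_def using pos by (intro mult_left_mono) auto
  qed
  have P1: "norm (T t s (P s x)) \<le> E * norm x" if "0 \<le> s" "s \<le> t" "t \<le> N" for t s x
    using bound_P[of s t x] mult_right_mono[OF eE[of s t s] norm_ge_zero[of x]] that by linarith
  define M1 where "M1 = E + E * norm (T N 0)"
  have M1: "0 \<le> M1" using E by (simp add: M1_def)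
  have T0: "norm (T t 0 x) \<le> M1 * norm x" if t: "0 \<le> t" "t \<le> N" for t x
  proof -
    have "norm (T t 0 (J 0 x)) = norm (T t 0 (J N (T N 0 x)))" using t J_T[of 0 N x] by simp
    also have "\<dots> \<le> D * exp (- lam * (\<rho> N - \<rho> t) + \<epsilon> * \<rho> N) * norm (T N 0 x)"
      using bound_J t by simp
    also have "\<dots> \<le> E * norm (T N 0 x)"
      using eE[of t N N] t by (intro mult_right_mono) auto
    also have "\<dots> \<le> E * (norm (T N 0) * norm x)"
      using E norm_blinfun by (intro mult_left_mono) auto
    finally have "norm (T t 0 (J 0 x)) \<le> E * (norm (T N 0) * norm x)" .
    then show ?thesis
      using P1[of 0 t x] T_split[of 0 t x] t norm_triangle_ineq[of "T t 0 (P 0 x)" "T t 0 (J 0 x)"]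
      by (simp add: M1_def algebra_simps)
  qed
  have "norm (T t s) \<le> E + M1 * E" if st: "0 \<le> s" "s \<le> t" "t \<le> N" for t s
  proof (rule norm_blinfun_bound)
    show "0 \<le> E + M1 * E" using E M1 by simp
    fix x
    have "norm (J s x) \<le> E * norm x"
      using bound_J0[of s N] norm_blinfun[of "J s" x] st unfolding E_def
      by (meson mult_right_mono norm_ge_zero order_trans)
    then have "norm (T t 0 (J s x)) \<le> M1 * (E * norm x)"
      using T0[of t "J s x"] st M1 by (meson mult_left_mono order_trans)
    then show "norm (T t s x) \<le> (E + M1 * E) * norm x"
      using P1[of s t x] T_split[of s t x] st norm_triangle_ineq[of "T t s (P s x)" "T t 0 (J s x)"]
      by (simp add: algebra_simps)
  qed
  then show ?thesis using E M1 by (intro exI[of _ "E + M1 * E"]) auto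
qed

lemma T_bound_apply:
  "\<exists>M\<ge>0. \<forall>t s x. 0 \<le> s \<and> s \<le> t \<and> t \<le> N \<longrightarrow> norm (T t s x) \<le> M * norm x"
  using T_bound[of N] by (meson mult_right_mono norm_blinfun norm_ge_zero order_trans)

text \<open>Freezing the second argument at \<open>t\<close> extends the kernel to the whole
  half-line without changing it for \<open>s \<le> t\<close>.\<close>

lemma kernel_T:
  assumes t: "0 \<le> t"
  shows "operator_kernel (\<lambda>s. T t (min s t))"
  unfolding operator_kernel_def strongly_continuous_on_def
proof (intro conjI allI)
  show "continuous_on {0..} (\<lambda>s. T t (min s t) x)" for x
    by (rule continuous_on_compose2[OF T_cont2[OF t, of x], of "{0..}" "\<lambda>s. min s t"])
       (use t in \<open>auto intro!: continuous_intros\<close>)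
  obtain M where "\<forall>t' s. 0 \<le> s \<and> s \<le> t' \<and> t' \<le> t \<longrightarrow> norm (T t' s) \<le> M"
    using T_bound[of t] by blast
  then show "\<exists>M. \<forall>s\<in>{0..N}. norm (T t (min s t)) \<le> M" for N
    using t by (intro exI[of _ M]) auto
qed

text \<open>For \<open>u \<le> v\<close> the difference \<open>J u x - J v x\<close> equals
  \<open>J v (T v u x - x)\<close>. The local bound on \<open>J\<close> thus turns continuity of
  \<open>T\<close> at the diagonal into continuity of \<open>J\<close>, with one of the two
  continuity properties of \<open>T\<close> for each side of \<open>t0\<close>.\<close>

lemma kernel_J: "operator_kernel J"
  unfolding operator_kernel_def strongly_continuous_on_def
proof (intro conjI allI)
  show "\<exists>M. \<forall>t\<in>{0..N}. norm (J t) \<le> M" for N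
    by (intro exI[of _ "D * exp (\<epsilon> * \<rho> N)"]) (auto intro: bound_J0)
  fix x
  show "continuous_on {0..} (\<lambda>t. J t x)"
    unfolding continuous_on_iff
  proof (intro ballI allI impI)
    fix t0 e :: real assume t0: "t0 \<in> {0..}" and e: "0 < e"
    define M where "M = D * exp (\<epsilon> * \<rho> (t0 + 1))"
    have M: "0 < M" "\<And>t. 0 \<le> t \<Longrightarrow> t \<le> t0 + 1 \<Longrightarrow> norm (J t) \<le> M"
      using pos bound_J0[of _ "t0 + 1"] by (auto simp: M_def)
    have eM: "0 < e / M" using e M by simp
    obtain d1 where d1: "d1 > 0"
      "\<And>t. t \<in> {t0..} \<Longrightarrow> dist t t0 < d1 \<Longrightarrow> dist (T t t0 x) (T t0 t0 x) < e / M"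
      using T_cont[of t0 x] t0 eM unfolding continuous_on_iff by (meson atLeast_iff order_refl)
    obtain d2 where d2: "d2 > 0"
      "\<And>t. t \<in> {0..t0} \<Longrightarrow> dist t t0 < d2 \<Longrightarrow> dist (T t0 t x) (T t0 t0 x) < e / M"
      using T_cont2[of t0 x] t0 eM unfolding continuous_on_iff
      by (meson atLeast_iff atLeastAtMost_iff order_refl)
    have key: "dist (J u x) (J v x) < e"
      if "0 \<le> u" "u \<le> v" "v \<le> t0 + 1" "norm (T v u x - x) < e / M" for u v
    proof -
      have "J u x - J v x = J v (T v u x - x)"
        using J_T[of u v x] that by (simp add: blinfun.diff_right)
      then have "norm (J u x - J v x) \<le> norm (J v) * norm (T v u x - x)"
        using norm_blinfun by simp
      also have "\<dots> \<le> M * norm (T v u x - x)" using M(2)[of v] that by (intro mult_right_mono) auto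
      also have "\<dots> < M * (e / M)" using that M by (intro mult_strict_left_mono) auto
      finally show ?thesis using M by (simp add: dist_norm)
    qed
    show "\<exists>d>0. \<forall>t\<in>{0..}. dist t t0 < d \<longrightarrow> dist (J t x) (J t0 x) < e"
    proof (intro exI[of _ "min 1 (min d1 d2)"] conjI ballI impI)
      fix t assume t: "t \<in> {0..}" "dist t t0 < min 1 (min d1 d2)"
      show "dist (J t x) (J t0 x) < e"
      proof (cases "t \<le> t0")
        case True
        then show ?thesis using key[of t t0] d2(2)[of t] t t0 by (auto simp: dist_norm)
      next
        case False
        then show ?thesis using key[of t0 t] d1(2)[of t] t t0
          by (auto simp: dist_norm norm_minus_commute dist_commute abs_less_iff)
      qed
    qed (use d1(1) d2(1) in auto)
  qed
qed

section \<open>The scalar majorant \<open>\<beta>\<close> and its integrals\<close>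

lemma rho_cont: "continuous_on {0..} \<rho>"
  using rho_deriv by (intro continuous_on_eq_continuous_within[THEN iffD2] ballI)
    (meson DERIV_continuous atLeast_iff)

definition "\<beta> t = exp (- a * \<rho> t) * \<rho>' t"

text \<open>The bound on \<open>B\<close> dominates a norm and is a positive multiple of
  \<open>\<rho>' t\<close>.\<close>

lemma rho'_nonneg: assumes "0 \<le> t" shows "0 \<le> \<rho>' t"
proof -
  have "0 \<le> \<delta> * exp (- (\<epsilon> + a) * \<rho> t) * \<rho>' t"
    using B_bound[OF assms] norm_ge_zero order_trans by blast
  moreover have "0 < \<delta> * exp (- (\<epsilon> + a) * \<rho> t)" using pos by simp
  ultimately show ?thesis by (meson zero_le_mult_iff not_le)
qed

lemma \<beta>_nonneg: "0 \<le> t \<Longrightarrow> 0 \<le> \<beta> t"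
  using rho'_nonneg by (simp add: \<beta>_def)

lemma kernel_B: "operator_kernel B"
  unfolding operator_kernel_def
proof (intro conjI B_cont allI)
  fix N :: real
  have "bounded ((\<lambda>t. \<delta> * exp (- (\<epsilon> + a) * \<rho> t) * \<rho>' t) ` {0..N})"
    by (intro compact_imp_bounded compact_continuous_image compact_Icc)
       (auto intro!: continuous_intros continuous_on_subset[OF rho_cont] continuous_on_subset[OF rho'_cont])
  then obtain M where M: "\<forall>t\<in>{0..N}. norm (\<delta> * exp (- (\<epsilon> + a) * \<rho> t) * \<rho>' t) \<le> M"
    unfolding bounded_iff by blast
  show "\<exists>M. \<forall>t\<in>{0..N}. norm (B t) \<le> M"
  proof (intro exI[of _ M] ballI)
    fix t assume t: "t \<in> {0..N}"
    then show "norm (B t) \<le> M" using M[rule_format, OF t] B_bound[of t] by simp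
  qed
qed

lemma \<beta>_integral:
  assumes "0 \<le> s" "s \<le> t"
  shows "(\<beta> has_integral (exp (- a * \<rho> s) - exp (- a * \<rho> t)) / a) {s..t}"
proof -
  have "(\<beta> has_integral (- exp (- a * \<rho> t) / a) - (- exp (- a * \<rho> s) / a)) {s..t}"
  proof (rule fundamental_theorem_of_calculus[OF assms(2)])
    fix x assume x: "x \<in> {s..t}"
    have "(\<rho> has_real_derivative \<rho>' x) (at x within {s..t})"
      by (rule DERIV_subset[OF rho_deriv]) (use x assms in auto)
    then have "((\<lambda>x. - exp (- a * \<rho> x) / a) has_real_derivative \<beta> x) (at x within {s..t})"
      unfolding \<beta>_def using pos by (auto intro!: derivative_eq_intros)
    then show "((\<lambda>x. - exp (- a * \<rho> x) / a) has_vector_derivative \<beta> x) (at x within {s..t})"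
      by (simp add: has_real_derivative_iff_has_vector_derivative)
  qed
  then show ?thesis by (simp add: diff_divide_distrib)
qed

lemma exp_rho_tendsto: "0 < c \<Longrightarrow> ((\<lambda>t. exp (- c * \<rho> t)) \<longlongrightarrow> 0) at_top"
  by (intro filterlim_compose[OF exp_at_bot])
     (use filterlim_tendsto_pos_mult_at_top[OF tendsto_const _ rho_lim, of c]
      in \<open>simp add: filterlim_uminus_at_top\<close>)

text \<open>The integrals over finite intervals increase to the claimed value, because the boundary
  term vanishes as \<open>\<rho>\<close> tends to infinity.\<close>

lemma \<beta>_integral_inf:
  assumes "0 \<le> s"
  shows "(\<beta> has_integral exp (- a * \<rho> s) / a) {s..}"
proof (rule has_integral_to_inf)
  show "\<beta> integrable_on {s..y}" for y
    using \<beta>_integral[of s y] assms by (cases "s \<le> y") (auto simp: has_integral_iff)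
  show "\<And>y. s \<le> y \<Longrightarrow> 0 \<le> \<beta> y" using \<beta>_nonneg assms by auto
  have "((\<lambda>y. (exp (- a * \<rho> s) - exp (- a * \<rho> y)) / a) \<longlongrightarrow> (exp (- a * \<rho> s) - 0) / a) at_top"
    by (intro tendsto_intros exp_rho_tendsto) (use pos in auto)
  moreover have "\<forall>\<^sub>F y in at_top. (exp (- a * \<rho> s) - exp (- a * \<rho> y)) / a = integral {s..y} \<beta>"
    using eventually_ge_at_top[of s]
    by eventually_elim (rule integral_unique[OF \<beta>_integral[OF assms], symmetric])
  ultimately show "((\<lambda>y. integral {s..y} \<beta>) \<longlongrightarrow> exp (- a * \<rho> s) / a) at_top"
    using tendsto_cong by fastforce
qed

section \<open>The Green operator\<close>

text \<open>Equal to the integral against the Green kernel (lemma \<open>K_green\<close>), but written so that the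
  Volterra equation for \<open>T\<close> is immediate and \<open>T\<close> is only inverted on the way back to time \<open>0\<close>.\<close>
definition "K \<phi> t = T t 0 (- integral {0..} (\<lambda>\<tau>. J \<tau> (B \<tau> (\<phi> \<tau>)))) +
  integral {0..t} (\<lambda>\<tau>. T t \<tau> (B \<tau> (\<phi> \<tau>)))"

text \<open>The weights whose weighted sup norms are compatible with the exponential factor of the
  Green kernel. One estimate of \<open>K\<close> then covers both the constant weight and the weight
  decaying away from \<open>s\<close>.\<close>

definition "weight w \<longleftrightarrow> (\<forall>t\<ge>0. 0 \<le> w t \<and> (\<forall>\<tau>\<ge>0. exp (- lam * \<bar>\<rho> t - \<rho> \<tau>\<bar>) * w \<tau> \<le> w t))"

lemma weight_1: "weight (\<lambda>_. 1)"
  using pos by (auto simp: weight_def)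

lemma weight_exp: "weight (\<lambda>t. exp (- lam * \<bar>\<rho> t - \<rho> s\<bar>))"
proof -
  \<comment> \<open>The triangle inequality in the time scale \<open>\<rho>\<close>.\<close>
  have "lam * \<bar>\<rho> t - \<rho> s\<bar> \<le> lam * \<bar>\<rho> t - \<rho> \<tau>\<bar> + lam * \<bar>\<rho> \<tau> - \<rho> s\<bar>" for t \<tau>
    unfolding distrib_left[symmetric] using pos by (intro mult_left_mono) auto
  then show ?thesis by (simp add: weight_def mult_exp_exp algebra_simps)
qed

lemma weight_nonneg: "weight w \<Longrightarrow> 0 \<le> t \<Longrightarrow> 0 \<le> w t"
  by (auto simp: weight_def)

definition "q = D * \<delta> / a"

lemma q_nonneg: "0 \<le> q" and q_less_1: "q < 1"
  using pos small by (simp_all add: q_def)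

lemma T_B_integrable:
  assumes "cont_except s \<phi>" "0 \<le> u" "v \<le> t"
  shows "(\<lambda>\<tau>. T t \<tau> (B \<tau> (\<phi> \<tau>))) integrable_on {u..v}"
proof (cases "u \<le> v")
  case True
  then have "operator_kernel (\<lambda>\<tau>. T t (min \<tau> t))" using assms by (intro kernel_T) auto
  then have "cont_except s (\<lambda>\<tau>. T t (min \<tau> t) (B \<tau> (\<phi> \<tau>)))"
    by (intro cont_except_kernel_apply kernel_B assms)
  from cont_except_integrable[OF this assms(2)] show ?thesis
    by (rule integrable_eq) (use assms in \<open>auto simp: min_def\<close>)
qed (simp add: integrable_on_empty)

lemma J_B_integrable:
  assumes "cont_except s \<phi>" "0 \<le> u"
  shows "(\<lambda>\<tau>. J \<tau> (B \<tau> (\<phi> \<tau>))) integrable_on {u..v}"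
  by (rule cont_except_integrable[OF
        cont_except_kernel_apply[OF kernel_J cont_except_kernel_apply[OF kernel_B assms(1)]] assms(2)])

text \<open>The common estimate for both halves of the Green kernel: the factor
  \<open>exp (\<epsilon> * \<rho> \<tau>)\<close> cancels against the bound on
  \<open>B \<tau>\<close> and leaves \<open>\<beta> \<tau>\<close>, while the weight absorbs the
  factor with \<open>lam\<close>.\<close>

lemma green_bound:
  assumes z: "norm z \<le> D * exp (- lam * \<bar>\<rho> t - \<rho> \<tau>\<bar> + \<epsilon> * \<rho> \<tau>) * norm (B \<tau> y)"
    and y: "norm y \<le> M * w \<tau>" and w: "weight w" and t: "0 \<le> t" "0 \<le> \<tau>" and M: "0 \<le> M"
  shows "norm z \<le> D * \<delta> * M * w t * \<beta> \<tau>"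
proof -
  let ?k = "\<delta> * exp (- (\<epsilon> + a) * \<rho> \<tau>) * \<rho>' \<tau>"
  have k: "0 \<le> ?k" using pos rho'_nonneg[of \<tau>] t by simp
  have "norm (B \<tau> y) \<le> norm (B \<tau>) * norm y" by (rule norm_blinfun)
  also have "\<dots> \<le> ?k * (M * w \<tau>)" using B_bound[of \<tau>] t y k by (intro mult_mono) auto
  finally have "D * exp (- lam * \<bar>\<rho> t - \<rho> \<tau>\<bar> + \<epsilon> * \<rho> \<tau>) * norm (B \<tau> y)
      \<le> D * exp (- lam * \<bar>\<rho> t - \<rho> \<tau>\<bar> + \<epsilon> * \<rho> \<tau>) * (?k * (M * w \<tau>))"
    using pos by (intro mult_left_mono) auto
  also have "\<dots> = D * \<delta> * M * (exp (- lam * \<bar>\<rho> t - \<rho> \<tau>\<bar>) * w \<tau>) *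
      (exp (\<epsilon> * \<rho> \<tau>) * exp (- (\<epsilon> + a) * \<rho> \<tau>) * \<rho>' \<tau>)"
    unfolding exp_add by (simp only: mult_ac)
  also have "exp (\<epsilon> * \<rho> \<tau>) * exp (- (\<epsilon> + a) * \<rho> \<tau>) = exp (- a * \<rho> \<tau>)"
    by (simp add: mult_exp_exp algebra_simps)
  also have "exp (- a * \<rho> \<tau>) * \<rho>' \<tau> = \<beta> \<tau>" by (simp add: \<beta>_def)
  also have "D * \<delta> * M * (exp (- lam * \<bar>\<rho> t - \<rho> \<tau>\<bar>) * w \<tau>) * \<beta> \<tau> \<le> D * \<delta> * M * w t * \<beta> \<tau>"
    using w pos M t \<beta>_nonneg[of \<tau>] unfolding weight_def by (intro mult_right_mono mult_left_mono) auto
  finally show ?thesis using z by linarith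
qed

lemma bound_J_B:
  assumes "norm (\<phi> \<tau>) \<le> M * w \<tau>" "weight w" "0 \<le> M" "0 \<le> t" "t \<le> \<tau>"
  shows "norm (T t 0 (J \<tau> (B \<tau> (\<phi> \<tau>)))) \<le> D * \<delta> * M * w t * \<beta> \<tau>"
  by (rule green_bound) (use assms bound_J[of t \<tau> "B \<tau> (\<phi> \<tau>)"] mono[of t \<tau>] in auto)

lemma bound_P_B:
  assumes "norm (\<phi> \<tau>) \<le> M * w \<tau>" "weight w" "0 \<le> M" "0 \<le> \<tau>" "\<tau> \<le> t"
  shows "norm (T t \<tau> (P \<tau> (B \<tau> (\<phi> \<tau>)))) \<le> D * \<delta> * M * w t * \<beta> \<tau>"
  by (rule green_bound) (use assms bound_P[of \<tau> t "B \<tau> (\<phi> \<tau>)"] mono[of \<tau> t] in auto)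

section \<open>Convergence, Volterra form and size of the Green operator\<close>

lemma J_B_integrable_inf:
  assumes "cont_except s \<phi>" "\<And>\<tau>. 0 \<le> \<tau> \<Longrightarrow> norm (\<phi> \<tau>) \<le> M" "0 \<le> t"
  shows "(\<lambda>\<tau>. J \<tau> (B \<tau> (\<phi> \<tau>))) integrable_on {t..}"
proof (rule integrable_on_all_intervals_integrable_bound)
  have M: "0 \<le> M" using assms(2)[of 0] norm_ge_zero order_trans by blast
  \<comment> \<open>At time 0 the operator \<open>T 0 0\<close> is the identity, so
    \<open>bound_J_B\<close> bounds the integrand itself.\<close>
  show "norm (J x (B x (\<phi> x))) \<le> D * \<delta> * M * 1 * \<beta> x" if "x \<in> {t..}" for x
    using bound_J_B[of \<phi> x M "\<lambda>_. 1" 0] assms weight_1 M that by auto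
  show "(\<lambda>x. D * \<delta> * M * 1 * \<beta> x) integrable_on {t..}"
    using \<beta>_integral_inf[OF assms(3)] by (intro integrable_on_mult_right) (auto simp: has_integral_iff)
  show "(\<lambda>x. if x \<in> {t..} then J x (B x (\<phi> x)) else 0) integrable_on cbox u v" for u v
  proof -
    have "(\<lambda>x. J x (B x (\<phi> x))) integrable_on {max t u..v}"
      using assms by (intro J_B_integrable) auto
    moreover have "{t..} \<inter> {u..v} = {max t u..v}" by auto
    ultimately show ?thesis by (simp add: integrable_restrict_Int del: atLeast_iff)
  qed
qed

text \<open>At time 0 only the integral of \<open>J\<close> remains, and \<open>P 0\<close>
  annihilates it under the integral sign. This puts the initial value of a solution into the
  unstable space.\<close>

lemma K_0_P:
  assumes "cont_except s \<phi>" "\<And>\<tau>. 0 \<le> \<tau> \<Longrightarrow> norm (\<phi> \<tau>) \<le> M"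
  shows "P 0 (K \<phi> 0) = 0"
proof -
  have "P 0 (integral {0..} (\<lambda>\<tau>. J \<tau> (B \<tau> (\<phi> \<tau>)))) = integral {0..} (\<lambda>\<tau>. P 0 (J \<tau> (B \<tau> (\<phi> \<tau>))))"
    using integral_linear[OF J_B_integrable_inf[OF assms order_refl] blinfun.bounded_linear_right[of "P 0"]]
    by (simp add: o_def)
  also have "\<dots> = integral {0..} (\<lambda>_::real. 0)" by (rule Henstock_Kurzweil_Integration.integral_cong) (simp add: P_J)
  finally show ?thesis by (simp add: K_def blinfun.minus_right)
qed

text \<open>The first term of \<open>K\<close> is an orbit of \<open>T\<close> from time 0, so only
  the second integral has to be cut at \<open>r\<close>; on \<open>{0..r}\<close> the operator
  \<open>T t r\<close> is moved inside it.\<close>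

lemma K_volterra:
  assumes "cont_except s \<phi>" "0 \<le> r" "r \<le> t"
  shows "K \<phi> t = T t r (K \<phi> r) + integral {r..t} (\<lambda>\<tau>. T t \<tau> (B \<tau> (\<phi> \<tau>)))"
proof -
  have "T t r (integral {0..r} (\<lambda>\<tau>. T r \<tau> (B \<tau> (\<phi> \<tau>)))) = integral {0..r} (\<lambda>\<tau>. T t r (T r \<tau> (B \<tau> (\<phi> \<tau>))))"
    using integral_linear[OF T_B_integrable[OF assms(1) order_refl order_refl] blinfun.bounded_linear_right[of "T t r"]]
    by (simp add: o_def)
  also have "\<dots> = integral {0..r} (\<lambda>\<tau>. T t \<tau> (B \<tau> (\<phi> \<tau>)))"
    by (intro Henstock_Kurzweil_Integration.integral_cong) (use assms T_comp in auto)
  finally have "T t r (integral {0..r} (\<lambda>\<tau>. T r \<tau> (B \<tau> (\<phi> \<tau>)))) + integral {r..t} (\<lambda>\<tau>. T t \<tau> (B \<tau> (\<phi> \<tau>)))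
      = integral {0..t} (\<lambda>\<tau>. T t \<tau> (B \<tau> (\<phi> \<tau>)))"
    using Henstock_Kurzweil_Integration.integral_combine[OF assms(2,3) T_B_integrable[OF assms(1) order_refl order_refl]]
    by simp
  then show ?thesis using T_comp[of 0 r t] assms
    by (simp add: K_def blinfun.add_right algebra_simps)
qed

lemma T_0_integral_J:
  assumes "cont_except s \<phi>" "0 \<le> t"
  shows "T t 0 (integral {0..t} (\<lambda>\<tau>. J \<tau> (B \<tau> (\<phi> \<tau>)))) = integral {0..t} (\<lambda>\<tau>. T t 0 (J \<tau> (B \<tau> (\<phi> \<tau>))))"
  using integral_linear[OF J_B_integrable[OF assms(1) order_refl] blinfun.bounded_linear_right[of "T t 0"]]
  by (simp add: o_def)

lemma integral_J_split:
  assumes "cont_except s \<phi>" "\<And>\<tau>. 0 \<le> \<tau> \<Longrightarrow> norm (\<phi> \<tau>) \<le> M" "0 \<le> t"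
  shows "integral {0..} (\<lambda>\<tau>. J \<tau> (B \<tau> (\<phi> \<tau>)))
    = integral {0..t} (\<lambda>\<tau>. J \<tau> (B \<tau> (\<phi> \<tau>))) + integral {t..} (\<lambda>\<tau>. J \<tau> (B \<tau> (\<phi> \<tau>)))"
proof -
  have "((\<lambda>\<tau>. J \<tau> (B \<tau> (\<phi> \<tau>))) has_integral integral {0..t} (\<lambda>\<tau>. J \<tau> (B \<tau> (\<phi> \<tau>))) +
      integral {t..} (\<lambda>\<tau>. J \<tau> (B \<tau> (\<phi> \<tau>)))) ({0..t} \<union> {t..})"
  proof (rule has_integral_Un)
    have "{0..t} \<inter> {t..} = {t}" using assms(3) by auto
    then show "negligible ({0..t} \<inter> {t..})" by simp
  qed (use J_B_integrable[OF assms(1) order_refl] J_B_integrable_inf[OF assms] in \<open>auto simp: has_integral_iff\<close>)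
  moreover have "{0..t} \<union> {t..} = {0..}" using assms(3) by auto
  ultimately show ?thesis by (simp add: integral_unique)
qed

text \<open>By \<open>T_split\<close>, the unstable part of the Volterra integral over
  \<open>{0..t}\<close> cancels the same part of the integral over the half-line and leaves the
  tail.\<close>

lemma K_green:
  assumes "cont_except s \<phi>" "\<And>\<tau>. 0 \<le> \<tau> \<Longrightarrow> norm (\<phi> \<tau>) \<le> M" "0 \<le> t"
  shows "K \<phi> t = integral {0..t} (\<lambda>\<tau>. T t \<tau> (P \<tau> (B \<tau> (\<phi> \<tau>))))
    - integral {t..} (\<lambda>\<tau>. T t 0 (J \<tau> (B \<tau> (\<phi> \<tau>))))"
proof -
  have "integral {0..t} (\<lambda>\<tau>. T t \<tau> (P \<tau> (B \<tau> (\<phi> \<tau>))))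
      = integral {0..t} (\<lambda>\<tau>. T t \<tau> (B \<tau> (\<phi> \<tau>)) - T t 0 (J \<tau> (B \<tau> (\<phi> \<tau>))))"
    by (intro Henstock_Kurzweil_Integration.integral_cong) (metis T_split add_diff_cancel_right' atLeastAtMost_iff)
  also have "\<dots> = integral {0..t} (\<lambda>\<tau>. T t \<tau> (B \<tau> (\<phi> \<tau>))) - integral {0..t} (\<lambda>\<tau>. T t 0 (J \<tau> (B \<tau> (\<phi> \<tau>))))"
    using integrable_linear[OF J_B_integrable[OF assms(1) order_refl] blinfun.bounded_linear_right[of "T t 0"]]
    by (intro Henstock_Kurzweil_Integration.integral_diff T_B_integrable[OF assms(1)]) (auto simp: o_def)
  moreover have "integral {t..} (\<lambda>\<tau>. T t 0 (J \<tau> (B \<tau> (\<phi> \<tau>)))) = T t 0 (integral {t..} (\<lambda>\<tau>. J \<tau> (B \<tau> (\<phi> \<tau>))))"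
    using integral_linear[OF J_B_integrable_inf[OF assms] blinfun.bounded_linear_right[of "T t 0"]]
    by (simp add: o_def)
  ultimately show ?thesis
    using integral_J_split[OF assms] T_0_integral_J[OF assms(1,3)]
    by (simp add: K_def blinfun.minus_right blinfun.add_right blinfun.diff_right)
qed

text \<open>The integrals of \<open>\<beta>\<close> over \<open>{0..t}\<close> and
  \<open>{t..}\<close> add up to \<open>1 / a\<close>, because \<open>\<rho> 0 = 0\<close>. The
  plain bound \<open>C\<close> secures convergence of the improper integral; the weighted bound
  gives the estimate.\<close>

lemma K_bound:
  assumes \<phi>: "cont_except s \<phi>" "\<And>\<tau>. 0 \<le> \<tau> \<Longrightarrow> norm (\<phi> \<tau>) \<le> C"
    and w: "\<And>\<tau>. 0 \<le> \<tau> \<Longrightarrow> norm (\<phi> \<tau>) \<le> M * w \<tau>" "weight w" and M: "0 \<le> M" and t: "0 \<le> t"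
  shows "norm (K \<phi> t) \<le> q * M * w t"
proof -
  let ?k = "D * \<delta> * M * w t"
  have "norm (integral {0..t} (\<lambda>\<tau>. T t \<tau> (P \<tau> (B \<tau> (\<phi> \<tau>))))) \<le> ?k * ((exp (- a * \<rho> 0) - exp (- a * \<rho> t)) / a)"
    by (rule integral_norm_bound_integral_le[OF has_integral_mult_right[OF \<beta>_integral]])
       (use t bound_P_B w M in auto)
  moreover have "norm (integral {t..} (\<lambda>\<tau>. T t 0 (J \<tau> (B \<tau> (\<phi> \<tau>))))) \<le> ?k * (exp (- a * \<rho> t) / a)"
    by (rule integral_norm_bound_integral_le[OF has_integral_mult_right[OF \<beta>_integral_inf[OF t]]])
       (use t bound_J_B w M in auto)
  ultimately have "norm (K \<phi> t) \<le> ?k * ((exp (- a * \<rho> 0) - exp (- a * \<rho> t)) / a) + ?k * (exp (- a * \<rho> t) / a)"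
    using norm_triangle_ineq4 K_green[OF \<phi> t] by (smt (verit))
  also have "\<dots> = q * M * w t" using pos by (simp add: rho_0 q_def field_simps)
  finally show ?thesis .
qed

text \<open>Pulled back to time 0, the Volterra integral is the head of the integral defining
  \<open>K \<phi> 0\<close> and cancels it.\<close>

lemma J_K:
  assumes \<phi>: "cont_except s \<phi>" "\<And>\<tau>. 0 \<le> \<tau> \<Longrightarrow> norm (\<phi> \<tau>) \<le> C" and t: "0 \<le> t"
  shows "J t (K \<phi> t) = - integral {t..} (\<lambda>\<tau>. J \<tau> (B \<tau> (\<phi> \<tau>)))"
proof -
  have "J t (integral {0..t} (\<lambda>\<tau>. T t \<tau> (B \<tau> (\<phi> \<tau>)))) = integral {0..t} (\<lambda>\<tau>. J t (T t \<tau> (B \<tau> (\<phi> \<tau>))))"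
    using integral_linear[OF T_B_integrable[OF assms(1) order_refl order_refl] blinfun.bounded_linear_right[of "J t"]]
    by (simp add: o_def)
  also have "\<dots> = integral {0..t} (\<lambda>\<tau>. J \<tau> (B \<tau> (\<phi> \<tau>)))"
    by (intro Henstock_Kurzweil_Integration.integral_cong) (use J_T in auto)
  moreover have "J t (T t 0 (K \<phi> 0)) = K \<phi> 0"
    using J_T[of 0 t] t J_0 K_0_P[OF \<phi>] by simp
  ultimately show ?thesis using K_volterra[OF \<phi>(1) order_refl t] integral_J_split[OF \<phi> t]
    by (simp add: blinfun.add_right K_def)
qed

text \<open>The tail left by \<open>J_K\<close> is dominated by the tail of the integral of
  \<open>\<beta>\<close>. This supplies the limit condition by which stable orbits are
  recognised.\<close>

lemma J_K_tendsto:
  assumes \<phi>: "cont_except s \<phi>" "\<And>\<tau>. 0 \<le> \<tau> \<Longrightarrow> norm (\<phi> \<tau>) \<le> C"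
  shows "((\<lambda>t. J t (K \<phi> t)) \<longlongrightarrow> 0) at_top"
proof (rule Lim_null_comparison)
  have C: "0 \<le> C" using assms(2)[of 0] norm_ge_zero order_trans by blast
  have "norm (J t (K \<phi> t)) \<le> D * \<delta> * C * 1 * (exp (- a * \<rho> t) / a)" if t: "0 \<le> t" for t
    unfolding J_K[OF \<phi> t, simplified] norm_minus_cancel
  proof (rule integral_norm_bound_integral_le[OF has_integral_mult_right[OF \<beta>_integral_inf[OF t]]])
    show "norm (J x (B x (\<phi> x))) \<le> D * \<delta> * C * 1 * \<beta> x" if "x \<in> {t..}" for x
      using bound_J_B[of \<phi> x C "\<lambda>_. 1" 0] \<phi> weight_1 C that t by auto
  qed
  then show "\<forall>\<^sub>F t in at_top. norm (J t (K \<phi> t)) \<le> D * \<delta> * C * 1 * (exp (- a * \<rho> t) / a)"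
    by (intro eventually_mono[OF eventually_ge_at_top[of 0]])
  have "((\<lambda>t. D * \<delta> * C * 1 * (exp (- a * \<rho> t) / a)) \<longlongrightarrow> D * \<delta> * C * 1 * (0 / a)) at_top"
    by (intro tendsto_intros exp_rho_tendsto) (use pos in auto)
  then show "((\<lambda>t. D * \<delta> * C * 1 * (exp (- a * \<rho> t) / a)) \<longlongrightarrow> 0) at_top" by simp
qed

lemma K_diff:
  assumes "cont_except s \<phi>" "\<And>\<tau>. 0 \<le> \<tau> \<Longrightarrow> norm (\<phi> \<tau>) \<le> C"
    and "cont_except s \<psi>" "\<And>\<tau>. 0 \<le> \<tau> \<Longrightarrow> norm (\<psi> \<tau>) \<le> C'"
    and "0 \<le> t"
  shows "K (\<lambda>\<tau>. \<phi> \<tau> - \<psi> \<tau>) t = K \<phi> t - K \<psi> t"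
proof -
  have "integral {0..} (\<lambda>\<tau>. J \<tau> (B \<tau> (\<phi> \<tau> - \<psi> \<tau>)))
      = integral {0..} (\<lambda>\<tau>. J \<tau> (B \<tau> (\<phi> \<tau>))) - integral {0..} (\<lambda>\<tau>. J \<tau> (B \<tau> (\<psi> \<tau>)))"
    unfolding blinfun.diff_right
    by (intro Henstock_Kurzweil_Integration.integral_diff J_B_integrable_inf[OF assms(1,2)] J_B_integrable_inf[OF assms(3,4)]) auto
  moreover have "integral {0..t} (\<lambda>\<tau>. T t \<tau> (B \<tau> (\<phi> \<tau> - \<psi> \<tau>)))
      = integral {0..t} (\<lambda>\<tau>. T t \<tau> (B \<tau> (\<phi> \<tau>))) - integral {0..t} (\<lambda>\<tau>. T t \<tau> (B \<tau> (\<psi> \<tau>)))"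
    unfolding blinfun.diff_right
    by (intro Henstock_Kurzweil_Integration.integral_diff T_B_integrable[OF assms(1)] T_B_integrable[OF assms(3)]) auto
  ultimately show ?thesis by (simp add: K_def blinfun.diff_right blinfun.minus_right)
qed

text \<open>Integration smooths out the jump of \<open>\<phi>\<close>. Restarting by
  \<open>K_volterra\<close> at a time \<open>r\<close> shortly before \<open>t0\<close> leaves an
  orbit of \<open>T\<close>, continuous in \<open>t\<close>, and an integral over a short
  interval.\<close>

lemma K_cont:
  assumes \<phi>: "cont_except s \<phi>"
  shows "continuous_on {0..} (K \<phi>)"
  unfolding continuous_on_iff
proof (intro ballI allI impI)
  fix t0 e :: real assume t0: "t0 \<in> {0..}" and e: "0 < e"
  obtain M where M: "0 \<le> M"
    "\<And>t \<tau> x. 0 \<le> \<tau> \<Longrightarrow> \<tau> \<le> t \<Longrightarrow> t \<le> t0 + 1 \<Longrightarrow> norm (T t \<tau> x) \<le> M * norm x"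
    using T_bound_apply[of "t0 + 1"] by blast
  obtain C where C: "0 \<le> C" "\<And>t. t \<in> {0..t0+1} \<Longrightarrow> norm (B t (\<phi> t)) \<le> C"
    using cont_except_bounded[OF cont_except_kernel_apply[OF kernel_B \<phi>], of "t0 + 1"] by blast
  define L where "L = M * C + 1"
  have L: "0 < L" using M C by (simp add: L_def add_nonneg_pos)
  \<comment> \<open>The interval from \<open>r\<close> to \<open>t\<close> has length at most
    \<open>2 * h\<close>, so its integral is at most \<open>e / 4\<close>. The bound
    \<open>h \<le> 1\<close> keeps all times below \<open>t0 + 1\<close>, where \<open>M\<close> and
    \<open>C\<close> apply.\<close>
  define h where "h = min 1 (e / (8 * L))"
  have h: "0 < h" "h \<le> 1" "L * h \<le> e / 8" using e L by (auto simp: h_def min_def field_simps)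
  define r where "r = max 0 (t0 - h)"
  have r: "0 \<le> r" "r \<le> t0" "t0 - h \<le> r" using t0 h by (auto simp: r_def)
  have short: "norm (K \<phi> t - T t r (K \<phi> r)) \<le> e / 4" if t: "r \<le> t" "t \<le> t0 + h" for t
  proof -
    have "norm (integral {r..t} (\<lambda>\<tau>. T t \<tau> (B \<tau> (\<phi> \<tau>)))) \<le> L * (t - r)"
    proof (rule integral_norm_bound_integral_le)
      show "((\<lambda>_. L) has_integral L * (t - r)) {r..t}"
        using has_integral_const_real[of L r t] t by (simp add: mult.commute)
      fix \<tau> assume \<tau>: "\<tau> \<in> {r..t}"
      have "norm (T t \<tau> (B \<tau> (\<phi> \<tau>))) \<le> M * norm (B \<tau> (\<phi> \<tau>))"
        using \<tau> r t h by (intro M) auto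
      also have "\<dots> \<le> M * C" using \<tau> r t h by (intro mult_left_mono C M) auto
      finally show "norm (T t \<tau> (B \<tau> (\<phi> \<tau>))) \<le> L" by (simp add: L_def)
    qed
    also have "\<dots> \<le> L * (2 * h)" using L r t by (intro mult_left_mono) auto
    also have "\<dots> \<le> e / 4" using h by simp
    finally show ?thesis using K_volterra[OF \<phi> r(1) t(1)] by simp
  qed
  obtain d where d: "d > 0" "\<And>t. t \<in> {r..} \<Longrightarrow> dist t t0 < d \<Longrightarrow> dist (T t r (K \<phi> r)) (T t0 r (K \<phi> r)) < e / 2"
    using T_cont[OF r(1), of "K \<phi> r"] r e unfolding continuous_on_iff by (meson atLeast_iff half_gt_zero)
  show "\<exists>d>0. \<forall>t\<in>{0..}. dist t t0 < d \<longrightarrow> dist (K \<phi> t) (K \<phi> t0) < e"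
  proof (intro exI[of _ "min h d"] conjI ballI impI)
    fix t assume t: "t \<in> {0..}" "dist t t0 < min h d"
    then have tr: "r \<le> t" "t \<le> t0 + h" by (auto simp: r_def dist_real_def)
    have "norm (T t r (K \<phi> r) - T t0 r (K \<phi> r)) < e / 2" using d(2)[of t] tr t by (auto simp: dist_norm)
    moreover have "norm (K \<phi> t - T t r (K \<phi> r)) \<le> e / 4" by (rule short[OF tr])
    moreover have "norm (K \<phi> t0 - T t0 r (K \<phi> r)) \<le> e / 4" by (rule short) (use r h in auto)
    ultimately show "dist (K \<phi> t) (K \<phi> t0) < e"
      unfolding dist_norm using norm_triangle_ineq4[of "K \<phi> t - T t r (K \<phi> r)" "K \<phi> t0 - T t0 r (K \<phi> r)"]
        norm_triangle_ineq[of "(K \<phi> t - T t r (K \<phi> r)) - (K \<phi> t0 - T t0 r (K \<phi> r))" "T t r (K \<phi> r) - T t0 r (K \<phi> r)"]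
      by (simp add: algebra_simps)
  qed (use h d in auto)
qed

text \<open>An exponential weight takes the place of Gronwall's inequality. With the rate
  \<open>2 * M\<close>, integrating \<open>M * exp (2 * M * \<tau>)\<close> yields half an
  exponential, so the maximum of the weighted norm is at most half of itself.\<close>

lemma volterra_unique:
  assumes r: "0 \<le> r" and u: "continuous_on {r..b} u"
    and eq: "\<And>t. t \<in> {r..b} \<Longrightarrow> u t = integral {r..t} (\<lambda>\<tau>. T t \<tau> (B \<tau> (u \<tau>)))"
    and t: "t \<in> {r..b}"
  shows "u t = 0"
proof -
  obtain M1 where M1: "0 \<le> M1"
    "\<And>t \<tau> x. 0 \<le> \<tau> \<Longrightarrow> \<tau> \<le> t \<Longrightarrow> t \<le> b \<Longrightarrow> norm (T t \<tau> x) \<le> M1 * norm x"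
    using T_bound_apply[of b] by blast
  obtain M2 where M2: "\<And>\<tau>. \<tau> \<in> {0..b} \<Longrightarrow> norm (B \<tau>) \<le> M2"
    using kernel_B unfolding operator_kernel_def by blast
  define M where "M = M1 * \<bar>M2\<bar> + 1"
  have M: "0 < M" using M1 by (simp add: M_def add_nonneg_pos)
  have TB: "norm (T t \<tau> (B \<tau> x)) \<le> M * norm x" if "0 \<le> \<tau>" "\<tau> \<le> t" "t \<le> b" for t \<tau> x
  proof -
    have "norm (T t \<tau> (B \<tau> x)) \<le> M1 * norm (B \<tau> x)" using M1 that by blast
    also have "\<dots> \<le> M1 * (\<bar>M2\<bar> * norm x)"
      using M1(1) M2[of \<tau>] that norm_blinfun[of "B \<tau>" x]
      by (intro mult_left_mono order_trans[OF norm_blinfun] mult_right_mono) auto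
    also have "\<dots> \<le> M * norm x" by (simp add: M_def distrib_right mult.assoc)
    finally show ?thesis .
  qed
  define f where "f t = norm (u t) * exp (- (2 * M * t))" for t
  have "continuous_on {r..b} f" unfolding f_def by (intro continuous_intros u)
  then obtain m where m: "m \<in> {r..b}" "\<And>x. x \<in> {r..b} \<Longrightarrow> f x \<le> f m"
    using continuous_attains_sup[of "{r..b}" f] t by auto
  have u_le: "norm (u x) \<le> f m * exp (2 * M * x)" if "x \<in> {r..b}" for x
  proof -
    have "norm (u x) = f x * exp (2 * M * x)" by (simp add: f_def mult_exp_exp)
    then show ?thesis using m(2)[OF that] by simp
  qed
  have fm: "0 \<le> f m" by (simp add: f_def)
  have "norm (u m) \<le> f m * (exp (2 * M * m) / 2 - exp (2 * M * r) / 2)"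
    unfolding eq[OF m(1)]
  proof (rule integral_norm_bound_integral_le[OF has_integral_mult_right])
    show "((\<lambda>\<tau>. M * exp (2 * M * \<tau>)) has_integral (exp (2 * M * m) / 2 - exp (2 * M * r) / 2)) {r..m}"
      by (rule fundamental_theorem_of_calculus)
        (use m in \<open>auto intro!: derivative_eq_intros simp flip: has_real_derivative_iff_has_vector_derivative\<close>)
    fix \<tau> assume \<tau>: "\<tau> \<in> {r..m}"
    have "norm (T m \<tau> (B \<tau> (u \<tau>))) \<le> M * norm (u \<tau>)" using \<tau> m r by (intro TB) auto
    also have "\<dots> \<le> M * (f m * exp (2 * M * \<tau>))" using M u_le \<tau> m by (intro mult_left_mono) auto
    finally show "norm (T m \<tau> (B \<tau> (u \<tau>))) \<le> f m * (M * exp (2 * M * \<tau>))" by (simp add: algebra_simps)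
  qed
  also have "\<dots> \<le> f m * (exp (2 * M * m) / 2)" using fm by (intro mult_left_mono) auto
  finally have "norm (u m) * exp (- (2 * M * m)) \<le> f m * (exp (2 * M * m) / 2) * exp (- (2 * M * m))"
    by (intro mult_right_mono) auto
  also have "\<dots> = f m / 2" by (simp add: mult_exp_exp)
  finally have "f m \<le> 0" by (simp add: f_def)
  then have "f t \<le> 0" using m(2)[OF t] by linarith
  then show ?thesis by (simp add: f_def mult_le_0_iff)
qed

section \<open>The splitting for the perturbed family\<close>

text \<open>A forcing of size \<open>M\<close> and its correction of size
  \<open>q * M / (1 - q)\<close> together have size \<open>M / (1 - q)\<close>: the source of the
  constant \<open>D / (1 - q)\<close>.\<close>

lemma add_geometric: "M + q * M / (1 - q) = M / (1 - q)"
proof -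
  have "p < 1 \<Longrightarrow> M + p * M / (1 - p) = M / (1 - p)" for p :: real by (simp add: field_simps)
  then show ?thesis using q_less_1 .
qed

text \<open>The unknown is the correction \<open>\<eta>\<close> and not the sum
  \<open>g + \<eta>\<close>: the sum jumps with \<open>g\<close>, whereas \<open>\<eta>\<close> is
  continuous and the contraction principle applies among bounded continuous functions.\<close>

lemma green_solution:
  assumes g: "cont_except s g" "\<And>t. 0 \<le> t \<Longrightarrow> norm (g t) \<le> M * w t"
    and w: "weight w" "\<And>t. 0 \<le> t \<Longrightarrow> w t \<le> 1" and M: "0 \<le> M"
  obtains \<eta> where "continuous_on {0..} \<eta>"
    "\<And>t. 0 \<le> t \<Longrightarrow> \<eta> t = K (\<lambda>\<tau>. g \<tau> + \<eta> \<tau>) t"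
    "\<And>t. 0 \<le> t \<Longrightarrow> norm (\<eta> t) \<le> q * M / (1 - q) * w t"
proof -
  define M' where "M' = q * M / (1 - q)"
  have M': "0 \<le> M'"
    unfolding M'_def using q_nonneg q_less_1 M by simp
  have fix_M': "q * (M + M') = M'" by (simp only: M'_def add_geometric times_divide_eq_right)
  \<comment> \<open>Bounded continuous functions live on the whole line, so at negative times the
    radius here and the image under \<open>F\<close> below are those of time 0.\<close>
  define S where "S = PiC UNIV (\<lambda>t. cball 0 (M' * w (max 0 t)) :: 'a set)"
  define F where "F f = Bcontfun (\<lambda>t. K (\<lambda>\<tau>. g \<tau> + apply_bcontfun f \<tau>) (max 0 t))" for f :: "real \<Rightarrow>\<^sub>C 'a"
  have g_bound: "norm (g t) \<le> M" if "0 \<le> t" for t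
    using g(2)[OF that] mult_left_mono[OF w(2)[OF that] M] by simp
  have ce: "cont_except s (\<lambda>\<tau>. g \<tau> + apply_bcontfun f \<tau>)" for f
    by (intro cont_except_add g continuous_imp_cont_except) auto
  have bd: "norm (g t + apply_bcontfun f t) \<le> M + norm f" if "0 \<le> t" for f t
    using g_bound[OF that] norm_bounded[of f t] by (intro norm_triangle_mono) auto
  have F_apply: "apply_bcontfun (F f) = (\<lambda>t. K (\<lambda>\<tau>. g \<tau> + apply_bcontfun f \<tau>) (max 0 t))" for f
    unfolding F_def
  proof (rule Bcontfun_inverse, rule bcontfun_normI)
    show "continuous_on UNIV (\<lambda>t. K (\<lambda>\<tau>. g \<tau> + apply_bcontfun f \<tau>) (max 0 t))"
      by (rule continuous_on_compose2[OF K_cont[OF ce]]) (auto intro!: continuous_intros)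
    show "norm (K (\<lambda>\<tau>. g \<tau> + apply_bcontfun f \<tau>) (max 0 t)) \<le> q * (M + norm f) * 1" for t
      by (rule K_bound[OF ce bd, where w = "\<lambda>_. 1"]) (use bd weight_1 M in auto)
  qed
  have "\<exists>!f\<in>S. F f = f"
  proof (rule Banach_fix[OF _ _ q_nonneg q_less_1])
    show "complete S" unfolding S_def complete_eq_closed by (intro closed_PiC) auto
    have "0 \<in> S" unfolding S_def using M' w by (auto simp: mem_PiC_iff weight_nonneg)
    then show "S \<noteq> {}" by blast
    show "F ` S \<subseteq> S"
    proof (rule image_subsetI)
      fix f assume f: "f \<in> S"
      have f': "norm (apply_bcontfun f t) \<le> M' * w t" if "0 \<le> t" for t
        using f that by (auto simp: S_def mem_PiC_iff Pi_iff max_def dest: spec[of _ t])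
      have sum_bound: "norm (g t + apply_bcontfun f t) \<le> (M + M') * w t" if "0 \<le> t" for t
        using norm_triangle_mono[OF g(2)[OF that] f'[OF that]] by (simp add: algebra_simps)
      have "norm (K (\<lambda>\<tau>. g \<tau> + apply_bcontfun f \<tau>) t) \<le> q * (M + M') * w t"
        if "0 \<le> t" for t
        by (rule K_bound[OF ce bd sum_bound w(1)]) (use M M' that in auto)
      then show "F f \<in> S" by (auto simp: S_def mem_PiC_iff F_apply fix_M')
    qed
    \<comment> \<open>The sup norm suffices for the contraction, since the decay is built into the
      closed set \<open>S\<close>. In the difference \<open>g\<close> cancels together with its
      jump.\<close>
    show "dist (F f) (F h) \<le> q * dist f h" for f h
    proof (rule dist_bound)
      fix t :: real
      have "K (\<lambda>\<tau>. g \<tau> + apply_bcontfun f \<tau>) (max 0 t) - K (\<lambda>\<tau>. g \<tau> + apply_bcontfun h \<tau>) (max 0 t)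
          = K (\<lambda>\<tau>. apply_bcontfun (f - h) \<tau>) (max 0 t)"
        using K_diff[OF ce bd ce bd, where t = "max 0 t"] by simp
      moreover have "norm (K (\<lambda>\<tau>. apply_bcontfun (f - h) \<tau>) (max 0 t)) \<le> q * norm (f - h) * 1"
        by (rule K_bound[where w = "\<lambda>_. 1" and s = 0 and C = "norm (f - h)"])
          (use weight_1 in \<open>auto intro: continuous_imp_cont_except norm_bounded
             simp del: minus_bcontfun.rep_eq\<close>)
      ultimately show "dist (F f t) (F h t) \<le> q * dist f h"
        by (simp add: F_apply dist_norm)
    qed
  qed
  then obtain f where f: "f \<in> S" "F f = f" by blast
  show ?thesis
  proof (rule that[of "apply_bcontfun f"])
    show "continuous_on {0..} (apply_bcontfun f)" by simp
    show "apply_bcontfun f t = K (\<lambda>\<tau>. g \<tau> + apply_bcontfun f \<tau>) t" if "0 \<le> t" for t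
      using fun_cong[OF F_apply[of f], of t] that f by simp
    show "norm (apply_bcontfun f t) \<le> q * M / (1 - q) * w t" if "0 \<le> t" for t
      using f that unfolding M'_def[symmetric]
      by (auto simp: S_def mem_PiC_iff Pi_iff max_def dest: spec[of _ t])
  qed
qed

text \<open>Each application of \<open>K\<close> improves a bound by the factor \<open>q\<close>, so
  iteration sends the bound to 0.\<close>

lemma K_fixpoint_zero:
  assumes \<phi>: "continuous_on {0..} \<phi>" "\<And>\<tau>. 0 \<le> \<tau> \<Longrightarrow> norm (\<phi> \<tau>) \<le> C"
    and eq: "\<And>t. 0 \<le> t \<Longrightarrow> \<phi> t = K \<phi> t" and t: "0 \<le> t"
  shows "\<phi> t = 0"
proof -
  have C: "0 \<le> C" using \<phi>(2)[of 0] norm_ge_zero order_trans by blast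
  have le: "norm (\<phi> t) \<le> q ^ n * C" if "0 \<le> t" for n t
    using that
  proof (induction n arbitrary: t)
    case (Suc n)
    have "norm (K \<phi> t) \<le> q * (q ^ n * C) * 1"
      by (rule K_bound[OF continuous_imp_cont_except[OF \<phi>(1)] \<phi>(2), where w = "\<lambda>_. 1"])
        (use Suc weight_1 C q_nonneg in auto)
    then show ?case using eq[OF Suc.prems] by (simp add: mult.assoc)
  qed (use \<phi> in auto)
  have "(\<lambda>n. q ^ n * C) \<longlonglongrightarrow> 0 * C"
    by (intro tendsto_intros LIMSEQ_realpow_zero) (use q_nonneg q_less_1 in auto)
  then have "norm (\<phi> t) \<le> 0"
    using le[OF t] by (intro LIMSEQ_le_const[of _ "0"]) auto
  then show ?thesis by simp
qed

lemma U_volterra: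
  assumes "0 \<le> s" "s \<le> t"
  shows "(\<lambda>\<tau>. T t \<tau> (B \<tau> (U \<tau> s x))) integrable_on {s..t}"
    and "U t s x = T t s x + integral {s..t} (\<lambda>\<tau>. T t \<tau> (B \<tau> (U \<tau> s x)))"
  using U_pert assms unfolding perturbed_by_def by blast+

text \<open>The difference to the orbit of \<open>U\<close> solves the homogeneous Volterra
  equation. This is how solutions of the Green equation become orbits of \<open>U\<close>.\<close>

lemma orbit_unique:
  assumes r: "0 \<le> r" and \<phi>: "continuous_on {0..} \<phi>"
    and eq: "\<And>t. t \<in> {r..b} \<Longrightarrow> \<phi> t = T t r (\<phi> r) + integral {r..t} (\<lambda>\<tau>. T t \<tau> (B \<tau> (\<phi> \<tau>)))"
    and t: "t \<in> {r..b}"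
  shows "\<phi> t = U t r (\<phi> r)"
proof -
  have "\<phi> t - U t r (\<phi> r) = 0"
  proof (rule volterra_unique[OF r _ _ t])
    show "continuous_on {r..b} (\<lambda>t. \<phi> t - U t r (\<phi> r))"
      by (intro continuous_on_diff continuous_on_subset[OF \<phi>] continuous_on_subset[OF U_cont[OF r]])
        (use r in auto)
    fix t assume t: "t \<in> {r..b}"
    have "integral {r..t} (\<lambda>\<tau>. T t \<tau> (B \<tau> (\<phi> \<tau> - U \<tau> r (\<phi> r))))
      = integral {r..t} (\<lambda>\<tau>. T t \<tau> (B \<tau> (\<phi> \<tau>))) - integral {r..t} (\<lambda>\<tau>. T t \<tau> (B \<tau> (U \<tau> r (\<phi> r))))"
      unfolding blinfun.diff_right
      by (intro Henstock_Kurzweil_Integration.integral_diff U_volterra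
          T_B_integrable[OF continuous_imp_cont_except[OF \<phi>]]) (use t r in auto)
    then show "\<phi> t - U t r (\<phi> r) = integral {r..t} (\<lambda>\<tau>. T t \<tau> (B \<tau> (\<phi> \<tau> - U \<tau> r (\<phi> r))))"
      using eq[OF t] U_volterra(2)[of r t "\<phi> r"] t r by simp
  qed
  then show ?thesis by simp
qed

section \<open>Stable initial values and the splitting they induce\<close>

text \<open>Boundedness alone does not single out the stable space: if \<open>\<epsilon> > lam\<close>, orbits starting in
  the kernel of \<open>P 0\<close> may be bounded as well.\<close>
definition stable_at :: "real \<Rightarrow> 'a \<Rightarrow> bool" where
  "stable_at s v \<longleftrightarrow> (\<exists>C. \<forall>t\<ge>s. norm (U t s v) \<le> C) \<and> ((\<lambda>t. J t (U t s v)) \<longlongrightarrow> 0) at_top"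

lemma stable_0: "stable_at s 0"
  by (auto simp: stable_at_def blinfun.zero_right)

lemma stable_add:
  assumes "stable_at s v" "stable_at s w"
  shows "stable_at s (v + w)"
proof -
  obtain C C' where "\<forall>t\<ge>s. norm (U t s v) \<le> C" "\<forall>t\<ge>s. norm (U t s w) \<le> C'"
    using assms unfolding stable_at_def by blast
  then have "\<forall>t\<ge>s. norm (U t s (v + w)) \<le> C + C'"
    by (simp add: blinfun.add_right norm_triangle_mono)
  moreover have "((\<lambda>t. J t (U t s (v + w))) \<longlongrightarrow> 0 + 0) at_top"
    unfolding blinfun.add_right using assms by (intro tendsto_add) (auto simp: stable_at_def)
  ultimately show ?thesis by (auto simp: stable_at_def)
qed

lemma stable_scaleR:
  assumes "stable_at s v"
  shows "stable_at s (k *\<^sub>R v)"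
proof -
  obtain C where "\<forall>t\<ge>s. norm (U t s v) \<le> C"
    using assms unfolding stable_at_def by blast
  then have "\<forall>t\<ge>s. norm (U t s (k *\<^sub>R v)) \<le> \<bar>k\<bar> * C"
    by (simp add: blinfun.scaleR_right mult_left_mono)
  moreover have "((\<lambda>t. J t (U t s (k *\<^sub>R v))) \<longlongrightarrow> k *\<^sub>R 0) at_top"
    unfolding blinfun.scaleR_right using assms by (intro tendsto_scaleR) (auto simp: stable_at_def)
  ultimately show ?thesis by (auto simp: stable_at_def)
qed

lemma stable_diff: "stable_at s v \<Longrightarrow> stable_at s w \<Longrightarrow> stable_at s (v - w)"
  using stable_add[of s v "- w"] stable_scaleR[of s w "-1"] by simp

lemma stable_iff_shift:
  assumes "0 \<le> s" "s \<le> t"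
  shows "((\<lambda>u. J u (U u t (U t s v))) \<longlongrightarrow> 0) at_top \<longleftrightarrow> ((\<lambda>u. J u (U u s v)) \<longlongrightarrow> 0) at_top"
  by (rule tendsto_cong, rule eventually_mono[OF eventually_ge_at_top[of t]])
    (use U_comp assms in simp)

lemma stable_invariant:
  assumes "stable_at s v" "0 \<le> s" "s \<le> t"
  shows "stable_at t (U t s v)"
proof -
  obtain C where "\<forall>t\<ge>s. norm (U t s v) \<le> C" using assms unfolding stable_at_def by blast
  then have "\<forall>u\<ge>t. norm (U u t (U t s v)) \<le> C" using U_comp assms by simp
  then show ?thesis using assms stable_iff_shift[of s t v] by (auto simp: stable_at_def)
qed

text \<open>The forcing \<open>g\<close> is the Green kernel of \<open>T\<close> with pole
  \<open>s\<close>, applied to \<open>x\<close>; its jump at \<open>s\<close> is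
  \<open>P s x + (x - P s x) = x\<close>. The continuous correction \<open>\<eta>\<close> preserves
  this jump, which is the splitting of \<open>x\<close>.\<close>

lemma split_exists:
  assumes s: "0 \<le> s"
  shows "\<exists>v w. x = v + U s 0 w \<and> P 0 w = 0 \<and> stable_at s v \<and>
    (\<forall>t\<ge>s. norm (U t s v) \<le> D / (1 - q) * exp (- lam * (\<rho> t - \<rho> s) + \<epsilon> * \<rho> s) * norm x) \<and>
    (\<forall>t\<in>{0..s}. norm (U t 0 w) \<le> D / (1 - q) * exp (- lam * (\<rho> s - \<rho> t) + \<epsilon> * \<rho> s) * norm x)"
proof -
  define w where "w t = exp (- lam * \<bar>\<rho> t - \<rho> s\<bar>)" for t
  have w: "weight w" "\<And>t. w t \<le> 1" "\<And>t. 0 \<le> w t"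
    using weight_exp[of s] pos unfolding w_def[abs_def] by auto
  define M where "M = D * exp (\<epsilon> * \<rho> s) * norm x"
  have M: "0 \<le> M" using pos by (simp add: M_def)
  \<comment> \<open>Each branch is frozen beyond \<open>s\<close>, by \<open>min\<close> here and by
    \<open>max\<close> below, to be continuous on the whole half-line.\<close>
  define g1 where "g1 t = - T (min t s) 0 (J s x)" for t
  define g2 where "g2 t = T (max t s) s (P s x)" for t
  define g where "g t = (if t < s then g1 t else g2 t)" for t
  have "continuous_on {0..} (\<lambda>t. T (min t s) 0 (J s x))"
    by (rule continuous_on_compose2[OF T_cont[OF order_refl]]) (use s in \<open>auto intro!: continuous_intros\<close>)
  moreover have "continuous_on {0..} (\<lambda>t. T (max t s) s (P s x))"
    by (rule continuous_on_compose2[OF T_cont[OF s]]) (auto intro!: continuous_intros)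
  ultimately have cont: "continuous_on {0..} g1" "continuous_on {0..} g2"
    unfolding g1_def g2_def by (auto intro: continuous_on_minus)
  have g: "cont_except s g" unfolding cont_except_def using cont by (auto simp: g_def)
  have g1_bound: "norm (g1 t) \<le> M * w t" if "0 \<le> t" "t \<le> s" for t
    using bound_J[of t s x] mono[of t s] that unfolding g1_def M_def w_def
    by (simp add: exp_add[symmetric] exp_diff[symmetric] mult_ac)
  have g2_bound: "norm (g2 t) \<le> M * w t" if "s \<le> t" for t
    using bound_P[of s t x] mono[of s t] s that unfolding g2_def M_def w_def
    by (simp add: exp_add[symmetric] exp_diff[symmetric] mult_ac)
  obtain \<eta> where \<eta>: "continuous_on {0..} \<eta>"
    "\<And>t. 0 \<le> t \<Longrightarrow> \<eta> t = K (\<lambda>\<tau>. g \<tau> + \<eta> \<tau>) t"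
    "\<And>t. 0 \<le> t \<Longrightarrow> norm (\<eta> t) \<le> q * M / (1 - q) * w t"
    by (rule green_solution[OF g _ w(1,2) M]) (use g1_bound g2_bound in \<open>auto simp: g_def\<close>)
  define \<phi> where "\<phi> t = g t + \<eta> t" for t
  define \<phi>1 where "\<phi>1 t = g1 t + \<eta> t" for t
  define \<phi>2 where "\<phi>2 t = g2 t + \<eta> t" for t
  have \<phi>: "cont_except s \<phi>"
    unfolding \<phi>_def[abs_def] by (intro cont_except_add g continuous_imp_cont_except \<eta>)
  have \<phi>12: "continuous_on {0..} \<phi>1" "continuous_on {0..} \<phi>2"
    unfolding \<phi>1_def[abs_def] \<phi>2_def[abs_def] by (intro continuous_on_add cont \<eta>)+
  have \<eta>_K: "\<eta> t = K \<phi> t" if "0 \<le> t" for t using \<eta>(2)[OF that] by (simp add: \<phi>_def[abs_def])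
  have sum: "M * w t + q * M / (1 - q) * w t = M / (1 - q) * w t" for t
    unfolding distrib_right[symmetric] add_geometric ..
  have \<phi>1_bound: "norm (\<phi>1 t) \<le> M / (1 - q) * w t" if "0 \<le> t" "t \<le> s" for t
    using norm_triangle_mono[OF g1_bound[OF that] \<eta>(3)[OF that(1)]] sum[of t] by (simp add: \<phi>1_def)
  have \<phi>2_bound: "norm (\<phi>2 t) \<le> M / (1 - q) * w t" if "s \<le> t" for t
    using norm_triangle_mono[OF g2_bound[OF that] \<eta>(3)[of t]] sum[of t] s that by (simp add: \<phi>2_def)
  have M1: "M / (1 - q) * w t \<le> M / (1 - q)" for t
    using w(2)[of t] M q_less_1 by (intro mult_left_le) auto
  have \<phi>_bound: "norm (\<phi> t) \<le> M / (1 - q)" if "0 \<le> t" for t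
    using \<phi>1_bound[of t] \<phi>2_bound[of t] M1[of t] that
    by (cases "t < s") (auto simp: \<phi>_def \<phi>1_def \<phi>2_def g_def)
  have orbit1: "\<phi>1 t = U t 0 (\<phi>1 0)" if t: "t \<in> {0..s}" for t
  proof (rule orbit_unique[OF order_refl \<phi>12(1) _ t])
    fix t assume t: "t \<in> {0..s}"
    \<comment> \<open>For \<open>t = s\<close> the integrands may differ at the end point, where
      \<open>\<phi>\<close> already follows the right branch.\<close>
    have "integral {0..t} (\<lambda>\<tau>. T t \<tau> (B \<tau> (\<phi> \<tau>))) = integral {0..t} (\<lambda>\<tau>. T t \<tau> (B \<tau> (\<phi>1 \<tau>)))"
      by (rule integral_spike[of "{s}"]) (use t in \<open>auto simp: \<phi>_def \<phi>1_def g_def\<close>)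
    moreover have "g1 t = T t 0 (g1 0)" using t s by (simp add: g1_def blinfun.minus_right)
    ultimately show "\<phi>1 t = T t 0 (\<phi>1 0) + integral {0..t} (\<lambda>\<tau>. T t \<tau> (B \<tau> (\<phi>1 \<tau>)))"
      using K_volterra[OF \<phi> order_refl, of t] \<eta>_K[of t] \<eta>_K[of 0] t by (simp add: \<phi>1_def blinfun.add_right)
  qed
  have orbit2: "\<phi>2 t = U t s (\<phi>2 s)" if t: "s \<le> t" for t
  proof (rule orbit_unique[OF s \<phi>12(2), of t])
    fix u assume u: "u \<in> {s..t}"
    have "integral {s..u} (\<lambda>\<tau>. T u \<tau> (B \<tau> (\<phi> \<tau>))) = integral {s..u} (\<lambda>\<tau>. T u \<tau> (B \<tau> (\<phi>2 \<tau>)))"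
      by (rule Henstock_Kurzweil_Integration.integral_cong) (auto simp: \<phi>_def \<phi>2_def g_def)
    moreover have "g2 u = T u s (g2 s)" using u s by (simp add: g2_def)
    ultimately show "\<phi>2 u = T u s (\<phi>2 s) + integral {s..u} (\<lambda>\<tau>. T u \<tau> (B \<tau> (\<phi>2 \<tau>)))"
      using K_volterra[OF \<phi> s, of u] \<eta>_K[of u] \<eta>_K[of s] u s by (simp add: \<phi>2_def blinfun.add_right)
  qed (use t in auto)
  have bound_eq: "M / (1 - q) * w t = D / (1 - q) * exp (- lam * \<bar>\<rho> t - \<rho> s\<bar> + \<epsilon> * \<rho> s) * norm x" for t
    by (simp add: M_def w_def mult_ac flip: exp_add)
  show ?thesis
  \<comment> \<open>The jump reads \<open>x = \<phi>2 s - \<phi>1 s\<close>, hence the minus sign in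
    the unstable witness.\<close>
  proof (rule exI[of _ "\<phi>2 s"], rule exI[of _ "- \<phi>1 0"], intro conjI allI ballI impI)
    have "g2 s - g1 s = x" using T_J[OF s, of x] s by (simp add: g1_def g2_def)
    then have "\<phi>2 s - \<phi>1 s = x" by (simp add: \<phi>1_def \<phi>2_def)
    then show "x = \<phi>2 s + U s 0 (- \<phi>1 0)" using orbit1[of s] s by (simp add: blinfun.minus_right)
    have "P 0 (\<eta> 0) = 0" using K_0_P[OF \<phi> \<phi>_bound] \<eta>_K[of 0] by simp
    then show "P 0 (- \<phi>1 0) = 0" using s P_J[OF s, of x]
      by (simp add: \<phi>1_def g1_def blinfun.minus_right blinfun.add_right blinfun.diff_right)
    show "stable_at s (\<phi>2 s)" unfolding stable_at_def
    proof (intro conjI exI[of _ "M / (1 - q)"] allI impI)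
      show "norm (U t s (\<phi>2 s)) \<le> M / (1 - q)" if "s \<le> t" for t
        using orbit2[OF that] \<phi>2_bound[OF that] M1[of t] by simp
      have "J t (K \<phi> t) = J t (U t s (\<phi>2 s))" if "s \<le> t" for t
      proof -
        \<comment> \<open>The forcing is stable after time \<open>s\<close>, so \<open>J t\<close>
          sees only the part \<open>K \<phi> t\<close>.\<close>
        have "J t (g2 t) = 0" using J_T[of s t "P s x"] J_P s that by (simp add: g2_def)
        then show ?thesis
          unfolding orbit2[OF that, symmetric] using \<eta>_K[of t] s that
          by (simp add: \<phi>2_def blinfun.add_right)
      qed
      then have "\<forall>\<^sub>F t in at_top. J t (K \<phi> t) = J t (U t s (\<phi>2 s))"
        by (intro eventually_mono[OF eventually_ge_at_top[of s]])
      then show "((\<lambda>t. J t (U t s (\<phi>2 s))) \<longlongrightarrow> 0) at_top"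
        using J_K_tendsto[OF \<phi> \<phi>_bound] tendsto_cong by fast
    qed
    show "norm (U t s (\<phi>2 s)) \<le> D / (1 - q) * exp (- lam * (\<rho> t - \<rho> s) + \<epsilon> * \<rho> s) * norm x" if "s \<le> t" for t
    proof -
      have "\<bar>\<rho> t - \<rho> s\<bar> = \<rho> t - \<rho> s" using mono[OF s that] by simp
      then show ?thesis using \<phi>2_bound[OF that] bound_eq[of t] by (simp only: orbit2[OF that, symmetric])
    qed
    show "norm (U t 0 (- \<phi>1 0)) \<le> D / (1 - q) * exp (- lam * (\<rho> s - \<rho> t) + \<epsilon> * \<rho> s) * norm x"
      if "t \<in> {0..s}" for t
    proof -
      have "\<bar>\<rho> t - \<rho> s\<bar> = \<rho> s - \<rho> t" using mono[of t s] that by simp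
      then show ?thesis using \<phi>1_bound[of t] that bound_eq[of t]
        by (simp only: orbit1[OF that, symmetric] blinfun.minus_right norm_minus_cancel atLeastAtMost_iff)
    qed
  qed
qed

text \<open>The orbit \<open>\<phi>\<close> of \<open>w\<close> is bounded, and its defect
  \<open>h = \<phi> - K \<phi>\<close> is an orbit of \<open>T\<close> in the unstable space. So
  \<open>J t (h t)\<close> is constantly \<open>h 0\<close>, yet it tends to 0 by stability. Hence
  \<open>\<phi>\<close> is a bounded fixed point of \<open>K\<close> and vanishes.\<close>

lemma split_unique:
  assumes s: "0 \<le> s" and w: "P 0 w = 0" and st: "stable_at s (U s 0 w)"
  shows "w = 0"
proof -
  define \<phi> where "\<phi> t = U t 0 w" for t
  have cont: "continuous_on {0..} \<phi>" unfolding \<phi>_def[abs_def] using U_cont[of 0 w] by simp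
  note ce = continuous_imp_cont_except[OF cont, of 0]
  obtain C1 where C1: "\<And>t. t \<in> {0..s} \<Longrightarrow> norm (\<phi> t) \<le> C1"
    using cont_except_bounded[OF ce] by blast
  obtain C2 where C2: "\<And>t. s \<le> t \<Longrightarrow> norm (U t s (U s 0 w)) \<le> C2" using st unfolding stable_at_def by blast
  have bd: "norm (\<phi> t) \<le> max C1 C2" if "0 \<le> t" for t
    using C1[of t] C2[of t] U_comp[of 0 s t w] that s by (cases "t \<le> s") (auto simp: \<phi>_def)
  define h where "h t = \<phi> t - K \<phi> t" for t
  have h: "h t = T t 0 (h 0)" if "0 \<le> t" for t
    using K_volterra[OF ce order_refl that] U_volterra(2)[OF order_refl that, of w] that
    by (simp add: h_def \<phi>_def[abs_def] blinfun.diff_right)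
  have "P 0 (\<phi> 0) = 0" using w by (simp add: \<phi>_def)
  then have "P 0 (h 0) = 0" using K_0_P[OF ce bd] by (simp add: h_def blinfun.diff_right)
  then have Jh: "J t (h t) = h 0" if "0 \<le> t" for t
    using h[OF that] J_T[of 0 t "h 0"] J_0 that by simp
  have "((\<lambda>t. J t (\<phi> t)) \<longlongrightarrow> 0) at_top"
    using st stable_iff_shift[OF order_refl s, of w] by (simp add: stable_at_def \<phi>_def)
  from tendsto_diff[OF this J_K_tendsto[OF ce bd]]
  have "((\<lambda>t. J t (h t)) \<longlongrightarrow> 0) at_top" by (simp add: h_def blinfun.diff_right)
  moreover have "\<forall>\<^sub>F t in at_top. J t (h t) = h 0"
    by (rule eventually_mono[OF eventually_ge_at_top[of 0]]) (rule Jh)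
  ultimately have "((\<lambda>t::real. h 0) \<longlongrightarrow> 0) at_top" using tendsto_cong by fast
  then have "h 0 = 0" by (simp add: tendsto_const_iff)
  then have "\<phi> t = K \<phi> t" if "0 \<le> t" for t using h[OF that] by (simp add: h_def blinfun.zero_right)
  from K_fixpoint_zero[OF cont bd this, of 0] show ?thesis by (simp add: \<phi>_def)
qed

lemma split_eq:
  assumes s: "0 \<le> s" and eq: "v + U s 0 w = v' + U s 0 w'"
    and "P 0 w = 0" "P 0 w' = 0" "stable_at s v" "stable_at s v'"
  shows "v = v' \<and> w = w'"
proof -
  have "v - v' = U s 0 (w' - w)" using eq by (simp add: blinfun.diff_right algebra_simps)
  moreover have "P 0 (w' - w) = 0" using assms by (simp add: blinfun.diff_right)
  ultimately have "w' - w = 0" using split_unique[OF s] stable_diff[of s v v'] assms by metis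
  then show ?thesis using eq by simp
qed

text \<open>The projection is the stable component of the splitting. Linearity, idempotence and
  invariance follow by exhibiting a decomposition and invoking its uniqueness; the bounds come with
  its existence.\<close>

lemma dichotomy_U:
  "nonuniform_exp_dichotomy_with \<rho> U lam (D / (1 - q)) \<epsilon>"
proof -
  define D' where "D' = D / (1 - q)"
  have D': "0 < D'" using pos q_less_1 by (simp add: D'_def)
  define dec where "dec s x v w \<longleftrightarrow> x = v + U s 0 w \<and> P 0 w = 0 \<and> stable_at s v" for s x v w
  have dec_unique: "v = v' \<and> w = w'" if "0 \<le> s" "dec s x v w" "dec s x v' w'" for s x v v' w w'
    using split_eq[of s v w v' w'] that by (auto simp: dec_def)
  define bounds where "bounds s x v w \<longleftrightarrow>
    (\<forall>t\<ge>s. norm (U t s v) \<le> D' * exp (- lam * (\<rho> t - \<rho> s) + \<epsilon> * \<rho> s) * norm x) \<and>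
    (\<forall>t\<in>{0..s}. norm (U t 0 w) \<le> D' * exp (- lam * (\<rho> s - \<rho> t) + \<epsilon> * \<rho> s) * norm x)"
    for s v w and x :: 'a
  have "\<forall>s x. \<exists>v w. 0 \<le> s \<longrightarrow> dec s x v w \<and> bounds s x v w"
    using split_exists unfolding dec_def bounds_def D'_def by blast
  then obtain V W where VW: "\<And>s x. 0 \<le> s \<Longrightarrow> dec s x (V s x) (W s x)"
    and bounds: "\<And>s x. 0 \<le> s \<Longrightarrow> bounds s x (V s x) (W s x)"
    by metis
  have V_bound: "norm (U t s (V s x)) \<le> D' * exp (- lam * (\<rho> t - \<rho> s) + \<epsilon> * \<rho> s) * norm x"
    if "0 \<le> s" "s \<le> t" for s t x
    using bounds[OF that(1)] that unfolding bounds_def by blast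
  have W_bound: "norm (U t 0 (W s x)) \<le> D' * exp (- lam * (\<rho> s - \<rho> t) + \<epsilon> * \<rho> s) * norm x"
    if "0 \<le> t" "t \<le> s" for s t x
    using bounds[of s x] that unfolding bounds_def by auto
  have decI: "V s x = v \<and> W s x = w" if "0 \<le> s" "dec s x v w" for s x v w
    using dec_unique[OF that(1) VW[OF that(1)] that(2)] .
  have add: "V s (x + y) = V s x + V s y \<and> W s (x + y) = W s x + W s y" if "0 \<le> s" for s x y
    using VW[OF that, of x] VW[OF that, of y]
    by (intro decI that) (auto simp: dec_def blinfun.add_right stable_add algebra_simps)
  have scale: "V s (k *\<^sub>R x) = k *\<^sub>R V s x \<and> W s (k *\<^sub>R x) = k *\<^sub>R W s x" if "0 \<le> s" for s k x
    using VW[OF that, of x]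
    by (intro decI that) (auto simp: dec_def blinfun.scaleR_right stable_scaleR simp flip: scaleR_add_right)
  have lin_V: "bounded_linear (V s)" if s: "0 \<le> s" for s
  proof (rule bounded_linear_intro)
    show "norm (V s x) \<le> norm x * (D' * exp (\<epsilon> * \<rho> s))" for x
      using V_bound[OF s order_refl, of x] s by (simp add: mult.commute)
  qed (use add scale s in auto)
  have lin_W: "bounded_linear (W s)" if s: "0 \<le> s" for s
  proof (rule bounded_linear_intro)
    show "norm (W s x) \<le> norm x * (D' * exp (- lam * (\<rho> s - \<rho> 0) + \<epsilon> * \<rho> s))" for x
      using W_bound[OF order_refl s, of x] by (simp add: mult.commute)
  qed (use add scale s in auto)
  define R where "R s = Blinfun (V s)" for s
  have R: "R s x = V s x" if "0 \<le> s" for s x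
    using lin_V[OF that] by (simp add: R_def bounded_linear_Blinfun_apply)
  have V_U: "V t (U t s x) = U t s (V s x) \<and> W t (U t s x) = W s x" if "0 \<le> s" "s \<le> t" for s t x
  proof (rule decI)
    show "dec t (U t s x) (U t s (V s x)) (W s x)"
      using VW[of s x] that stable_invariant[of s "V s x" t] U_comp[of 0 s t "W s x"]
      unfolding dec_def by (metis blinfun.add_right order_refl)
  qed (use that in auto)
  \<comment> \<open>The unstable spaces of \<open>U\<close> are transported from the kernel of
    \<open>P 0\<close>, which makes surjectivity between them immediate.\<close>
  have ker_R: "ker (R s) = U s 0 ` ker (P 0)" if s: "0 \<le> s" for s
  proof (intro subset_antisym subsetI)
    fix x assume "x \<in> ker (R s)"
    then show "x \<in> U s 0 ` ker (P 0)" using VW[OF s, of x] R[OF s] by (auto simp: ker_def dec_def)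
  next
    fix x assume "x \<in> U s 0 ` ker (P 0)"
    then obtain w where w: "x = U s 0 w" "P 0 w = 0" by (auto simp: ker_def)
    then have "dec s x 0 w" by (simp add: dec_def stable_0)
    then show "x \<in> ker (R s)" using decI[OF s] R[OF s] by (auto simp: ker_def)
  qed
  have inj: "inj_on (U t s) (ker (R s))" if st: "0 \<le> s" "s \<le> t" for s t
  proof (rule inj_onI)
    fix x y assume "x \<in> ker (R s)" "y \<in> ker (R s)" and eq: "U t s x = U t s y"
    then have "x \<in> U s 0 ` ker (P 0)" "y \<in> U s 0 ` ker (P 0)" using ker_R[OF st(1)] by simp_all
    then obtain w w' where w: "x = U s 0 w" "y = U s 0 w'" "P 0 w = 0" "P 0 w' = 0"
      unfolding ker_def by blast
    then have "U t 0 w = U t 0 w'" using eq U_comp[of 0 s t] st by simp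
    \<comment> \<open>Uniqueness of the splitting at the later time \<open>t\<close>, with stable
      components 0.\<close>
    then show "x = y" using split_eq[of t 0 w 0 w'] w st stable_0 by simp
  qed
  have img: "U t s ` ker (R s) = ker (R t)" if st: "0 \<le> s" "s \<le> t" for s t
    using ker_R[of s] ker_R[of t] st U_comp[of 0 s t] by (simp add: image_image)
  \<comment> \<open>This explicit form of the backward operator gives its linearity and its
    bound.\<close>
  have backward_U: "backward U R t s ((id_blinfun - R s) x) = U t 0 (W s x)" if ts: "0 \<le> t" "t \<le> s" for t s x
  proof -
    have w: "P 0 (W s x) = 0" "x = V s x + U s 0 (W s x)" using VW[of s x] ts by (auto simp: dec_def)
    have "(id_blinfun - R s) x = U s t (U t 0 (W s x))"
      using w(2) ts U_comp[of 0 t s "W s x"] R[of s x] by (simp add: blinfun.diff_left algebra_simps)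
    moreover have "U t 0 (W s x) \<in> ker (R t)" using ker_R[OF ts(1)] w by (auto simp: ker_def)
    ultimately show ?thesis unfolding backward_def using inj[OF ts] by (simp add: inv_into_f_f)
  qed
  show ?thesis
    unfolding nonuniform_exp_dichotomy_with_def D'_def[symmetric]
  proof (intro conjI exI[of _ R] allI impI; (elim conjE)?)
    show "R t o\<^sub>L R t = R t" if t: "0 \<le> t" for t
    proof (rule blinfun_eqI)
      fix x
      have "dec t (V t x) (V t x) 0" using VW[OF t, of x] by (simp add: dec_def blinfun.zero_right)
      then show "(R t o\<^sub>L R t) x = R t x" using decI[OF t] R[OF t] by simp
    qed
    show "U t s o\<^sub>L R s = R t o\<^sub>L U t s" if "s \<le> t" "0 \<le> s" for t s
      using V_U[of s t] R that by (intro blinfun_eqI) simp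
    show "bij_betw (U t s) (ker (R s)) (ker (R t))" if "s \<le> t" "0 \<le> s" for t s
      using inj img that by (simp add: bij_betw_def)
    show "norm (U t s o\<^sub>L R s) \<le> D' * exp (- lam * (\<rho> t - \<rho> s) + \<epsilon> * \<rho> s)" if "s \<le> t" "0 \<le> s" for t s
      using V_bound[of s t] R[of s] that D' by (intro norm_blinfun_bound) auto
    fix t s :: real assume ts: "0 \<le> t" "t \<le> s"
    then have s: "0 \<le> s" by simp
    show "bounded_linear (\<lambda>x. backward U R t s ((id_blinfun - R s) x))"
      unfolding backward_U[OF ts] using bounded_linear_compose[OF blinfun.bounded_linear_right lin_W[OF s]]
      by blast
    show "onorm (\<lambda>x. backward U R t s ((id_blinfun - R s) x))
           \<le> D' * exp (- lam * (\<rho> s - \<rho> t) + \<epsilon> * \<rho> s)"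
      unfolding backward_U[OF ts] using W_bound[OF ts] D' by (intro onorm_bound) auto
  qed (use pos D' in auto)
qed

end

section \<open>From the dichotomy of \<open>T\<close> to the operators \<open>J\<close>, and the
  choice of the threshold\<close>

theorem corollary1:
  fixes \<rho> \<rho>' :: "real \<Rightarrow> real"
    and T :: "real \<Rightarrow> real \<Rightarrow> ('a::banach \<Rightarrow>\<^sub>L 'a)"
    and lam D \<epsilon> :: real
  assumes "\<forall>t\<ge>0. \<rho> t \<ge> 0"
    and "strict_mono_on {0..} \<rho>"
    and "\<forall>t\<ge>0. (\<rho> has_real_derivative \<rho>' t) (at t within {0..})"
    and "continuous_on {0..} \<rho>'"
    and "\<rho> 0 = 0"
    and "filterlim \<rho> at_top at_top"
    and "evolution_family T"
    and "nonuniform_exp_dichotomy_with \<rho> T lam D \<epsilon>"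
  shows "\<forall>a>0. \<exists>\<delta>\<^sub>0>0. \<forall>\<delta>\<in>{0<..<\<delta>\<^sub>0}.
           \<forall>(B :: real \<Rightarrow> ('a \<Rightarrow>\<^sub>L 'a)) (U :: real \<Rightarrow> real \<Rightarrow> ('a \<Rightarrow>\<^sub>L 'a)).
             strongly_continuous_on {0..} B \<and>
             (\<forall>t\<ge>0. norm (B t) \<le> \<delta> * exp (- (\<epsilon> + a) * \<rho> t) * \<rho>' t) \<and>
             evolution_family U \<and> perturbed_by T B U \<longrightarrow>
             nonuniform_exp_dichotomy \<rho> U"
proof -
  have pos: "0 < lam" "0 < D" "0 \<le> \<epsilon>"
    using assms(8) unfolding nonuniform_exp_dichotomy_with_def by simp_all
  obtain P where P: "\<forall>t\<ge>0. P t o\<^sub>L P t = P t"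
      "\<forall>t s. t \<ge> s \<and> s \<ge> 0 \<longrightarrow> T t s o\<^sub>L P s = P t o\<^sub>L T t s"
      "\<forall>t s. t \<ge> s \<and> s \<ge> 0 \<longrightarrow> bij_betw (T t s) (ker (P s)) (ker (P t))"
      "\<forall>t s. t \<ge> s \<and> s \<ge> 0 \<longrightarrow>
         norm (T t s o\<^sub>L P s) \<le> D * exp (- lam * (\<rho> t - \<rho> s) + \<epsilon> * \<rho> s)"
      "\<forall>t s. 0 \<le> t \<and> t \<le> s \<longrightarrow>
         bounded_linear (\<lambda>x. backward T P t s ((id_blinfun - P s) x)) \<and>
         onorm (\<lambda>x. backward T P t s ((id_blinfun - P s) x))
           \<le> D * exp (- lam * (\<rho> s - \<rho> t) + \<epsilon> * \<rho> s)"
    using assms(8) unfolding nonuniform_exp_dichotomy_with_def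
    by (elim conjE exE) (rule that; assumption)
  note P_idem = P(1)[rule_format] and T_P = P(2)[rule_format, OF conjI]
    and bij = P(3)[rule_format, OF conjI] and bound_P = P(4)[rule_format, OF conjI]
    and lin = P(5)[rule_format, OF conjI, THEN conjunct1]
    and bound_J = P(5)[rule_format, OF conjI, THEN conjunct2]
  define J where "J t = Blinfun (\<lambda>x. backward T P 0 t ((id_blinfun - P t) x))" for t
  have J: "J t x = backward T P 0 t (x - P t x)" if "0 \<le> t" for t x
    using lin[OF order_refl that] by (simp add: J_def bounded_linear_Blinfun_apply blinfun.diff_left)
  have PP: "P t (P t x) = P t x" if "0 \<le> t" for t x
    using P_idem[OF that] by (metis blinfun_apply_blinfun_compose)
  have TP: "T t s (P s x) = P t (T t s x)" if "0 \<le> s" "s \<le> t" for t s x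
    using T_P[OF that(2,1)] by (metis blinfun_apply_blinfun_compose)
  \<comment> \<open>Surjectivity between the kernels at times 0 and \<open>t\<close>; it makes
    \<open>inv_into\<close> a genuine preimage at \<open>x - P t x\<close>.\<close>
  have Q_ker: "x - P t x \<in> T t 0 ` ker (P 0)" if "0 \<le> t" for t x
    using bij[OF that order_refl] PP[OF that] by (simp add: bij_betw_def ker_def blinfun.diff_right)
  have PJ: "P 0 (J t x) = 0" if "0 \<le> t" for t x
    using inv_into_into[OF Q_ker[OF that, of x]] J[OF that] by (simp add: backward_def ker_def)
  have TJ: "T t 0 (J t x) = x - P t x" if "0 \<le> t" for t x
    using f_inv_into_f[OF Q_ker[OF that, of x]] J[OF that] by (simp add: backward_def)
  have T_comp: "T t s (T s r x) = T t r x" if "0 \<le> r" "r \<le> s" "s \<le> t" for r s t x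
    using assms(7) that unfolding evolution_family_def by (metis blinfun_apply_blinfun_compose)
  have JT: "J t (T t s x) = J s x" if "0 \<le> s" "s \<le> t" for t s x
  proof -
    have t: "0 \<le> t" using that by simp
    have "T t 0 (J t (T t s x)) = T t 0 (J s x)"
      using TJ[OF t, of "T t s x"] TP[OF that, of x, symmetric] TJ[OF that(1), of x]
        T_comp[of 0 s t "J s x", symmetric] that by (simp add: blinfun.diff_right)
    \<comment> \<open>Both vectors lie in the kernel of \<open>P 0\<close>, where
      \<open>T t 0\<close> is injective.\<close>
    then show ?thesis
      using inj_onD[OF bij_betw_imp_inj_on[OF bij[OF t order_refl]]] PJ[OF t, of "T t s x"] PJ[OF that(1), of x]
      by (simp add: ker_def)
  qed
  have TJ_bound: "norm (T t 0 (J s x)) \<le> D * exp (- lam * (\<rho> s - \<rho> t) + \<epsilon> * \<rho> s) * norm x"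
    if ts: "0 \<le> t" "t \<le> s" for t s x
  proof -
    have s: "0 \<le> s" using ts by simp
    have "P t (T t 0 (J s x)) = 0" using TP[of 0 t "J s x", symmetric] PJ[OF s] ts by (simp add: blinfun.zero_right)
    moreover have "T s t (T t 0 (J s x)) = x - P s x" using T_comp[of 0 t s "J s x"] TJ[OF s] ts by simp
    \<comment> \<open>The vector \<open>T t 0 (J s x)\<close> lies in the kernel of
      \<open>P t\<close> and is mapped to \<open>x - P s x\<close>, so it is the backward
      image.\<close>
    ultimately have "backward T P t s (x - P s x) = T t 0 (J s x)"
      unfolding backward_def
      by (intro inv_into_f_eq bij_betw_imp_inj_on[OF bij[OF ts(2,1)]]) (auto simp: ker_def)
    then have "norm (T t 0 (J s x)) \<le> onorm (\<lambda>x. backward T P t s ((id_blinfun - P s) x)) * norm x"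
      using onorm[OF lin[OF ts], of x] by (simp add: blinfun.diff_left)
    then show ?thesis using mult_right_mono[OF bound_J[OF ts] norm_ge_zero[of x]] by linarith
  qed
  have TP_bound: "norm (T t s (P s x)) \<le> D * exp (- lam * (\<rho> t - \<rho> s) + \<epsilon> * \<rho> s) * norm x"
    if st: "0 \<le> s" "s \<le> t" for t s x
    using norm_blinfun[of "T t s o\<^sub>L P s" x] mult_right_mono[OF bound_P[OF st(2,1)] norm_ge_zero[of x]]
    by simp
  have mono: "\<rho> s \<le> \<rho> t" if "0 \<le> s" "s \<le> t" for s t
    using strict_mono_on_leD[OF assms(2), of s t] that by simp
  show ?thesis
  proof (intro allI impI)
    fix a :: real assume a: "0 < a"
    show "\<exists>\<delta>\<^sub>0>0. \<forall>\<delta>\<in>{0<..<\<delta>\<^sub>0}. \<forall>B U. strongly_continuous_on {0..} B \<and>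
             (\<forall>t\<ge>0. norm (B t) \<le> \<delta> * exp (- (\<epsilon> + a) * \<rho> t) * \<rho>' t) \<and>
             evolution_family U \<and> perturbed_by T B U \<longrightarrow> nonuniform_exp_dichotomy \<rho> U"
    \<comment> \<open>The threshold \<open>a / D\<close> is exactly what makes the contraction
      constant \<open>D * \<delta> / a\<close> less than 1.\<close>
    proof (intro exI[of _ "a / D"] conjI ballI allI impI; (elim conjE)?)
      show "0 < a / D" using a pos by simp
      fix \<delta> B U
      assume \<delta>: "\<delta> \<in> {0<..<a / D}" and B: "strongly_continuous_on {0..} B"
        "\<forall>t\<ge>0. norm (B t) \<le> \<delta> * exp (- (\<epsilon> + a) * \<rho> t) * \<rho>' t"
        and U: "evolution_family U" "perturbed_by T B U"
      have "perturbed_dichotomy \<rho> \<rho>' T U P J B lam D \<epsilon> a \<delta>"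
      proof
        show "D * \<delta> / a < 1" using \<delta> pos a by (simp add: field_simps)
      qed (use assms B U mono PP TP PJ TJ JT TP_bound TJ_bound pos a \<delta> in auto)
      then show "nonuniform_exp_dichotomy \<rho> U"
        using perturbed_dichotomy.dichotomy_U unfolding nonuniform_exp_dichotomy_def by blast
    qed
  qed
qed

end
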